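(* Let $\mathbb{A}$ be a residually finite, finitely generated modal algebra such that the variety $\operatorname{HSP}(\mathbb{A})$ generated by $\mathbb{A}$ has equationally definable principal congruences. Then the profinite completion $(\mu,\hat{\mathbb{A}})$ is (isomorphic, as a completion, to) the MacNeille completion of $\mathbb{A}$, and $\Diamond$ is smooth.
   Context: A modal algebra is a Boolean algebra with a unary operation $\Diamond$ satisfying $\Diamond 0=0$ and $\Diamond(a\vee b)=\Diamond a\vee\Diamond b$. A variety $\mathcal{V}$ has equationally definable principal congruences (EDPC) if there are finitely many pairs of terms $p_i(x,y,z,w),q_i(x,y,z,w)$ such that for every $\mathbb{B}\in\mathcal{V}$ and $a,b,c,d\in B$: $(c,d)$ lies in the congruence generated by $(a,b)$ iff $p_i(a,b,c,d)=q_i(a,b,c,d)$ for all $i$. $\Phi_{\mathbb{A}}$ denotes the set of congruences $\theta$ of $\mathbb{A}$ with $\mathbb{A}/\theta$ finite; $\mathbb{A}$ is residually finite if for all $a\ne b$ there is $\theta\in\Phi_{\mathbb{A}}$ with $a/\theta\ne b/\theta$. The profinite completion is $\hat{\mathbb{A}}=\{\alpha\in\prod_{\theta\in\Phi_{\mathbb{A}}}\mathbb{A}/\theta\mid$ for all $\theta\subseteq\psi$ in $\Phi_{\mathbb{A}}$, if $\alpha(\theta)=a/\theta$ then $\alpha(\psi)=a/\psi\}$, with $\mu(a)=(a/\theta)_{\theta}$. A completion of a lattice $\mathbb{B}$ is a lattice embedding $m\colon\mathbb{B}\hookrightarrow\mathbb{C}$ into a complete lattice; the MacNeille completion $(m,\bar{\mathbb{B}})$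 is the completion (unique up to isomorphism commuting with the embeddings) in which $m[B]$ is join-dense. For order-preserving $f\colon\mathbb{B}\to\mathbb{B}$, the lower extension is $f^\circ(x)=\bigvee\{m(f(a))\mid m(a)\le x\}$ and the upper extension is $f^\bullet(x)=\bigwedge\{m(f(a))\mid x\le m(a)\}$ on $\bar{\mathbb{B}}$; $f$ is smooth if $f^\circ=f^\bullet$. *)

theory Defs
  imports "HOL-Algebra.Complete_Lattice" "HOL-Library.FuncSet" "HOL-Library.Countable_Set"
begin

section \<open>Modal algebras\<close>

record 'a modal_algebra = "'a partial_object" +
  mjoin :: "'a \<Rightarrow> 'a \<Rightarrow> 'a"
  mmeet :: "'a \<Rightarrow> 'a \<Rightarrow> 'a"
  mcompl :: "'a \<Rightarrow> 'a"
  mbot :: 'a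
  mtop :: 'a
  mdia :: "'a \<Rightarrow> 'a"

definition subuniverse :: "'a modal_algebra \<Rightarrow> 'a set \<Rightarrow> bool" where
  "subuniverse A S \<longleftrightarrow> S \<subseteq> carrier A \<and> mbot A \<in> S \<and> mtop A \<in> S \<and>
     (\<forall>x\<in>S. mcompl A x \<in> S \<and> mdia A x \<in> S) \<and>
     (\<forall>x\<in>S. \<forall>y\<in>S. mjoin A x y \<in> S \<and> mmeet A x y \<in> S)"

locale modal_algebra =
  fixes A :: "'a modal_algebra"
  assumes closed: "subuniverse A (carrier A)"
    and join_assoc: "\<lbrakk>x \<in> carrier A; y \<in> carrier A; z \<in> carrier A\<rbrakk> \<Longrightarrow>
      mjoin A (mjoin A x y) z = mjoin A x (mjoin A y z)"
    and meet_assoc: "\<lbrakk>x \<in> carrier A; y \<in> carrier A; z \<in> carrier A\<rbrakk> \<Longrightarrow>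
      mmeet A (mmeet A x y) z = mmeet A x (mmeet A y z)"
    and join_comm: "\<lbrakk>x \<in> carrier A; y \<in> carrier A\<rbrakk> \<Longrightarrow> mjoin A x y = mjoin A y x"
    and meet_comm: "\<lbrakk>x \<in> carrier A; y \<in> carrier A\<rbrakk> \<Longrightarrow> mmeet A x y = mmeet A y x"
    and join_absorb: "\<lbrakk>x \<in> carrier A; y \<in> carrier A\<rbrakk> \<Longrightarrow> mjoin A x (mmeet A x y) = x"
    and meet_absorb: "\<lbrakk>x \<in> carrier A; y \<in> carrier A\<rbrakk> \<Longrightarrow> mmeet A x (mjoin A x y) = x"
    and meet_join_distrib: "\<lbrakk>x \<in> carrier A; y \<in> carrier A; z \<in> carrier A\<rbrakk> \<Longrightarrow>
      mmeet A x (mjoin A y z) = mjoin A (mmeet A x y) (mmeet A x z)"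
    and join_compl: "x \<in> carrier A \<Longrightarrow> mjoin A x (mcompl A x) = mtop A"
    and meet_compl: "x \<in> carrier A \<Longrightarrow> mmeet A x (mcompl A x) = mbot A"
    and dia_bot: "mdia A (mbot A) = mbot A"
    and dia_join: "\<lbrakk>x \<in> carrier A; y \<in> carrier A\<rbrakk> \<Longrightarrow>
      mdia A (mjoin A x y) = mjoin A (mdia A x) (mdia A y)"

definition lattice_of :: "'a modal_algebra \<Rightarrow> 'a gorder" where
  "lattice_of A = \<lparr>carrier = carrier A, eq = (=), le = (\<lambda>x y. mjoin A x y = y)\<rparr>"

definition generated :: "'a modal_algebra \<Rightarrow> 'a set \<Rightarrow> 'a set" where
  "generated A X = \<Inter>{S. subuniverse A S \<and> X \<subseteq> S}"

definition finitely_generated :: "'a modal_algebra \<Rightarrow> bool" where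
  "finitely_generated A \<longleftrightarrow> (\<exists>X. finite X \<and> X \<subseteq> carrier A \<and> generated A X = carrier A)"

definition modal_hom :: "'a modal_algebra \<Rightarrow> 'b modal_algebra \<Rightarrow> ('a \<Rightarrow> 'b) set" where
  "modal_hom A B = {h \<in> carrier A \<rightarrow> carrier B. h (mbot A) = mbot B \<and> h (mtop A) = mtop B \<and>
     (\<forall>x\<in>carrier A. h (mcompl A x) = mcompl B (h x) \<and> h (mdia A x) = mdia B (h x)) \<and>
     (\<forall>x\<in>carrier A. \<forall>y\<in>carrier A.
        h (mjoin A x y) = mjoin B (h x) (h y) \<and> h (mmeet A x y) = mmeet B (h x) (h y))}"

definition power_algebra :: "'a modal_algebra \<Rightarrow> 'i set \<Rightarrow> ('i \<Rightarrow> 'a) modal_algebra" where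
  "power_algebra A I = \<lparr>carrier = I \<rightarrow>\<^sub>E carrier A,
     mjoin = (\<lambda>f g. \<lambda>i\<in>I. mjoin A (f i) (g i)), mmeet = (\<lambda>f g. \<lambda>i\<in>I. mmeet A (f i) (g i)),
     mcompl = (\<lambda>f. \<lambda>i\<in>I. mcompl A (f i)), mbot = (\<lambda>i\<in>I. mbot A), mtop = (\<lambda>i\<in>I. mtop A),
     mdia = (\<lambda>f. \<lambda>i\<in>I. mdia A (f i))\<rparr>"

text \<open>The members of \<open>HSP(A)\<close> with carrier in the type \<^typ>\<open>'b\<close>: homomorphic images of
  subalgebras of powers of \<open>A\<close>. Index sets of type \<^typ>\<open>('b \<Rightarrow> 'a) set\<close> lose nothing:
  see \<open>HSP_I\<close>, where the index type is arbitrary. Likewise EDPC of the members of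
  \<open>HSP(A)\<close> over \<^typ>\<open>nat\<close> is EDPC of the whole variety: see \<open>has_EDPC_any_type\<close>.\<close>

definition HSP :: "'a modal_algebra \<Rightarrow> 'b modal_algebra set" where
  "HSP A = {B. \<exists>(I :: ('b \<Rightarrow> 'a) set) S h. subuniverse (power_algebra A I) S \<and>
     h \<in> modal_hom (power_algebra A I\<lparr>carrier := S\<rparr>) B \<and> h ` S = carrier B}"


section \<open>Congruences and EDPC\<close>

definition congruence :: "'a modal_algebra \<Rightarrow> ('a \<times> 'a) set \<Rightarrow> bool" where
  "congruence A \<theta> \<longleftrightarrow> equiv (carrier A) \<theta> \<and>
     (\<forall>(x, x')\<in>\<theta>. (mcompl A x, mcompl A x') \<in> \<theta> \<and> (mdia A x, mdia A x') \<in> \<theta>) \<and>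
     (\<forall>(x, x')\<in>\<theta>. \<forall>(y, y')\<in>\<theta>.
        (mjoin A x y, mjoin A x' y') \<in> \<theta> \<and> (mmeet A x y, mmeet A x' y') \<in> \<theta>)"

definition principal_congruence :: "'a modal_algebra \<Rightarrow> 'a \<Rightarrow> 'a \<Rightarrow> ('a \<times> 'a) set" where
  "principal_congruence A a b = \<Inter>{\<theta>. congruence A \<theta> \<and> (a, b) \<in> \<theta>}"

datatype 'v modal_term =
    Var 'v
  | Join "'v modal_term" "'v modal_term"
  | Meet "'v modal_term" "'v modal_term"
  | Compl "'v modal_term"
  | Bot
  | Top
  | Dia "'v modal_term"

primrec eval_term :: "'a modal_algebra \<Rightarrow> ('v \<Rightarrow> 'a) \<Rightarrow> 'v modal_term \<Rightarrow> 'a" where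
  "eval_term A \<rho> (Var v) = \<rho> v"
| "eval_term A \<rho> (Join s t) = mjoin A (eval_term A \<rho> s) (eval_term A \<rho> t)"
| "eval_term A \<rho> (Meet s t) = mmeet A (eval_term A \<rho> s) (eval_term A \<rho> t)"
| "eval_term A \<rho> (Compl t) = mcompl A (eval_term A \<rho> t)"
| "eval_term A \<rho> Bot = mbot A"
| "eval_term A \<rho> Top = mtop A"
| "eval_term A \<rho> (Dia t) = mdia A (eval_term A \<rho> t)"

datatype var4 = VX | VY | VZ | VW

definition assign4 :: "'a \<Rightarrow> 'a \<Rightarrow> 'a \<Rightarrow> 'a \<Rightarrow> var4 \<Rightarrow> 'a" where
  "assign4 a b c d v = (case v of VX \<Rightarrow> a | VY \<Rightarrow> b | VZ \<Rightarrow> c | VW \<Rightarrow> d)"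

definition defines_principal_congruences ::
    "(var4 modal_term \<times> var4 modal_term) set \<Rightarrow> 'b modal_algebra \<Rightarrow> bool" where
  "defines_principal_congruences P B \<longleftrightarrow>
     (\<forall>a\<in>carrier B. \<forall>b\<in>carrier B. \<forall>c\<in>carrier B. \<forall>d\<in>carrier B.
        (c, d) \<in> principal_congruence B a b \<longleftrightarrow>
        (\<forall>(p, q)\<in>P. eval_term B (assign4 a b c d) p = eval_term B (assign4 a b c d) q))"

definition has_EDPC :: "'b modal_algebra set \<Rightarrow> bool" where
  "has_EDPC V \<longleftrightarrow> (\<exists>P. finite P \<and> (\<forall>B\<in>V. defines_principal_congruences P B))"


section \<open>Profinite completion\<close>

definition finite_congruences :: "'a modal_algebra \<Rightarrow> ('a \<times> 'a) set set" where
  "finite_congruences A = {\<theta>. congruence A \<theta> \<and> finite (carrier A // \<theta>)}"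

definition residually_finite :: "'a modal_algebra \<Rightarrow> bool" where
  "residually_finite A \<longleftrightarrow> (\<forall>a\<in>carrier A. \<forall>b\<in>carrier A. a \<noteq> b \<longrightarrow>
     (\<exists>\<theta>\<in>finite_congruences A. \<theta> `` {a} \<noteq> \<theta> `` {b}))"

definition quotient_algebra :: "'a modal_algebra \<Rightarrow> ('a \<times> 'a) set \<Rightarrow> 'a set modal_algebra" where
  "quotient_algebra A \<theta> = \<lparr>carrier = carrier A // \<theta>,
     mjoin = (\<lambda>U V. \<Union>x\<in>U. \<Union>y\<in>V. \<theta> `` {mjoin A x y}),
     mmeet = (\<lambda>U V. \<Union>x\<in>U. \<Union>y\<in>V. \<theta> `` {mmeet A x y}),
     mcompl = (\<lambda>U. \<Union>x\<in>U. \<theta> `` {mcompl A x}),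
     mbot = \<theta> `` {mbot A}, mtop = \<theta> `` {mtop A},
     mdia = (\<lambda>U. \<Union>x\<in>U. \<theta> `` {mdia A x})\<rparr>"

definition profinite_completion ::
    "'a modal_algebra \<Rightarrow> (('a \<times> 'a) set \<Rightarrow> 'a set) modal_algebra" where
  "profinite_completion A = (let \<Phi> = finite_congruences A; Q = quotient_algebra A in
     \<lparr>carrier = {\<alpha> \<in> (\<Pi>\<^sub>E \<theta>\<in>\<Phi>. carrier (Q \<theta>)). \<forall>\<theta>\<in>\<Phi>. \<forall>\<psi>\<in>\<Phi>. \<theta> \<subseteq> \<psi> \<longrightarrow>
        (\<forall>a\<in>carrier A. \<alpha> \<theta> = \<theta> `` {a} \<longrightarrow> \<alpha> \<psi> = \<psi> `` {a})},
      mjoin = (\<lambda>\<alpha> \<beta>. \<lambda>\<theta>\<in>\<Phi>. mjoin (Q \<theta>) (\<alpha> \<theta>) (\<beta> \<theta>)),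
      mmeet = (\<lambda>\<alpha> \<beta>. \<lambda>\<theta>\<in>\<Phi>. mmeet (Q \<theta>) (\<alpha> \<theta>) (\<beta> \<theta>)),
      mcompl = (\<lambda>\<alpha>. \<lambda>\<theta>\<in>\<Phi>. mcompl (Q \<theta>) (\<alpha> \<theta>)),
      mbot = (\<lambda>\<theta>\<in>\<Phi>. mbot (Q \<theta>)), mtop = (\<lambda>\<theta>\<in>\<Phi>. mtop (Q \<theta>)),
      mdia = (\<lambda>\<alpha>. \<lambda>\<theta>\<in>\<Phi>. mdia (Q \<theta>) (\<alpha> \<theta>))\<rparr>)"

definition profinite_map :: "'a modal_algebra \<Rightarrow> 'a \<Rightarrow> ('a \<times> 'a) set \<Rightarrow> 'a set" where
  "profinite_map A a = (\<lambda>\<theta>\<in>finite_congruences A. \<theta> `` {a})"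


section \<open>Completions of lattices and smoothness\<close>

definition lattice_completion :: "'a gorder \<Rightarrow> ('a \<Rightarrow> 'c) \<Rightarrow> 'c gorder \<Rightarrow> bool" where
  "lattice_completion L m C \<longleftrightarrow> complete_lattice C \<and>
     m \<in> carrier L \<rightarrow> carrier C \<and> inj_on m (carrier L) \<and>
     (\<forall>x\<in>carrier L. \<forall>y\<in>carrier L.
        m (x \<squnion>\<^bsub>L\<^esub> y) = m x \<squnion>\<^bsub>C\<^esub> m y \<and> m (x \<sqinter>\<^bsub>L\<^esub> y) = m x \<sqinter>\<^bsub>C\<^esub> m y)"

definition join_dense :: "'c gorder \<Rightarrow> 'c set \<Rightarrow> bool" where
  "join_dense C D \<longleftrightarrow> (\<forall>x\<in>carrier C. \<exists>S\<subseteq>D. x = \<Squnion>\<^bsub>C\<^esub> S)"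

definition meet_dense :: "'c gorder \<Rightarrow> 'c set \<Rightarrow> bool" where
  "meet_dense C D \<longleftrightarrow> (\<forall>x\<in>carrier C. \<exists>S\<subseteq>D. x = \<Sqinter>\<^bsub>C\<^esub> S)"

text \<open>Among all lattice completions, join-density alone does not determine the MacNeille
  completion (the ideal lattice also has it); join-density together with meet-density does.
  For completions that are Boolean algebras the two density conditions are equivalent.\<close>

definition macneille_completion :: "'a gorder \<Rightarrow> ('a \<Rightarrow> 'c) \<Rightarrow> 'c gorder \<Rightarrow> bool" where
  "macneille_completion L m C \<longleftrightarrow> lattice_completion L m C \<and>
     join_dense C (m ` carrier L) \<and> meet_dense C (m ` carrier L)"

definition lower_extension ::
    "'a gorder \<Rightarrow> ('a \<Rightarrow> 'c) \<Rightarrow> 'c gorder \<Rightarrow> ('a \<Rightarrow> 'a) \<Rightarrow> 'c \<Rightarrow> 'c" where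
  "lower_extension L m C f x = \<Squnion>\<^bsub>C\<^esub> {m (f a) | a. a \<in> carrier L \<and> m a \<sqsubseteq>\<^bsub>C\<^esub> x}"

definition upper_extension ::
    "'a gorder \<Rightarrow> ('a \<Rightarrow> 'c) \<Rightarrow> 'c gorder \<Rightarrow> ('a \<Rightarrow> 'a) \<Rightarrow> 'c \<Rightarrow> 'c" where
  "upper_extension L m C f x = \<Sqinter>\<^bsub>C\<^esub> {m (f a) | a. a \<in> carrier L \<and> x \<sqsubseteq>\<^bsub>C\<^esub> m a}"

text \<open>Here \<open>(m, C)\<close> is meant to be a MacNeille completion of \<open>L\<close>; which one does not matter.\<close>

definition smooth :: "'a gorder \<Rightarrow> ('a \<Rightarrow> 'c) \<Rightarrow> 'c gorder \<Rightarrow> ('a \<Rightarrow> 'a) \<Rightarrow> bool" where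
  "smooth L m C f \<longleftrightarrow>
     (\<forall>x\<in>carrier C. lower_extension L m C f x = upper_extension L m C f x)"


section \<open>Independence of the type restrictions in HSP and EDPC\<close>

lemma power_algebra_simps [simp]:
  "carrier (power_algebra A I) = I \<rightarrow>\<^sub>E carrier A"
  "mjoin (power_algebra A I) f g = (\<lambda>i\<in>I. mjoin A (f i) (g i))"
  "mmeet (power_algebra A I) f g = (\<lambda>i\<in>I. mmeet A (f i) (g i))"
  "mcompl (power_algebra A I) f = (\<lambda>i\<in>I. mcompl A (f i))"
  "mbot (power_algebra A I) = (\<lambda>i\<in>I. mbot A)"
  "mtop (power_algebra A I) = (\<lambda>i\<in>I. mtop A)"
  "mdia (power_algebra A I) f = (\<lambda>i\<in>I. mdia A (f i))"
  by (simp_all add: power_algebra_def)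

lemma HSP_I:
  fixes A :: "'a modal_algebra" and B :: "'b modal_algebra" and I :: "'i set"
  assumes A: "subuniverse A (carrier A)"
    and S: "subuniverse (power_algebra A I) S"
    and h: "h \<in> modal_hom (power_algebra A I\<lparr>carrier := S\<rparr>) B"
    and onto: "h ` S = carrier B"
  shows "B \<in> HSP A"
proof -
  have "\<forall>b\<in>carrier B. \<exists>s\<in>S. h s = b"
    using onto by (metis imageE)
  then obtain s where s: "\<And>b. b \<in> carrier B \<Longrightarrow> s b \<in> S \<and> h (s b) = b"
    by metis
  define r where "r i = (\<lambda>b\<in>carrier B. s b i)" for i
  define J where "J = r ` I"
  define \<phi> where "\<phi> g = (\<lambda>i\<in>I. g (r i))" for g :: "('b \<Rightarrow> 'a) \<Rightarrow> 'a"
  define T where "T = {g \<in> J \<rightarrow>\<^sub>E carrier A. \<phi> g \<in> S}"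
  have rJ: "r i \<in> J" if "i \<in> I" for i
    using that by (simp add: J_def)
  have S_sub: "S \<subseteq> I \<rightarrow>\<^sub>E carrier A"
    using S by (simp add: subuniverse_def)
  have \<phi>_ops:
    "\<phi> (\<lambda>i\<in>J. mjoin A (f i) (g i)) = (\<lambda>i\<in>I. mjoin A (\<phi> f i) (\<phi> g i))"
    "\<phi> (\<lambda>i\<in>J. mmeet A (f i) (g i)) = (\<lambda>i\<in>I. mmeet A (\<phi> f i) (\<phi> g i))"
    "\<phi> (\<lambda>i\<in>J. mcompl A (f i)) = (\<lambda>i\<in>I. mcompl A (\<phi> f i))"
    "\<phi> (\<lambda>i\<in>J. mdia A (f i)) = (\<lambda>i\<in>I. mdia A (\<phi> f i))"
    "\<phi> (\<lambda>i\<in>J. mbot A) = (\<lambda>i\<in>I. mbot A)" "\<phi> (\<lambda>i\<in>J. mtop A) = (\<lambda>i\<in>I. mtop A)" for f g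
    by (auto simp: \<phi>_def rJ fun_eq_iff)
  have "subuniverse (power_algebra A J) T"
    using S A unfolding subuniverse_def T_def
    by (auto simp: \<phi>_ops PiE_iff extensional_def)
  moreover have "h \<circ> \<phi> \<in> modal_hom (power_algebra A J\<lparr>carrier := T\<rparr>) B"
    using h unfolding modal_hom_def by (auto simp: \<phi>_ops T_def Pi_iff)
  moreover have "(h \<circ> \<phi>) ` T = carrier B"
  proof
    show "(h \<circ> \<phi>) ` T \<subseteq> carrier B"
      using onto by (auto simp: T_def)
    show "carrier B \<subseteq> (h \<circ> \<phi>) ` T"
    proof
      fix b assume b: "b \<in> carrier B"
      define g where "g = (\<lambda>j\<in>J. j b)"
      have "\<phi> g = s b"
      proof
        fix i
        have "g (r i) = s b i" if "i \<in> I"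
          unfolding g_def using rJ[OF that] b by (simp add: r_def)
        moreover have "s b i = undefined" if "i \<notin> I"
          using s[OF b] S_sub that by (meson PiE_arb subsetD)
        ultimately show "\<phi> g i = s b i" by (simp add: \<phi>_def)
      qed
      moreover have "g \<in> J \<rightarrow>\<^sub>E carrier A"
        using s[OF b] S_sub b by (auto simp: g_def J_def r_def PiE_iff)
      ultimately show "b \<in> (h \<circ> \<phi>) ` T"
        using s[OF b] by (auto simp: T_def intro!: image_eqI[of _ _ g])
    qed
  qed
  ultimately show ?thesis
    unfolding HSP_def by blast
qed

lemma modal_hom_image_closed:
  assumes "subuniverse D (carrier D)" "h \<in> modal_hom D B" "h ` carrier D = carrier B"
  shows "subuniverse B (carrier B)"
proof -
  have "subuniverse B (h ` carrier D)"
    unfolding subuniverse_def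
  proof (intro conjI ballI subsetI)
    note D = assms(1)[unfolded subuniverse_def] and h = assms(2)[unfolded modal_hom_def]
    {
      fix x y assume "x \<in> h ` carrier D" "y \<in> h ` carrier D"
      then obtain s t where st: "s \<in> carrier D" "t \<in> carrier D" "x = h s" "y = h t" by blast
      then have "mjoin B x y = h (mjoin D s t)" "mmeet B x y = h (mmeet D s t)"
        "mcompl B x = h (mcompl D s)" "mdia B x = h (mdia D s)"
        using h by simp_all
      with D st show "mjoin B x y \<in> h ` carrier D" "mmeet B x y \<in> h ` carrier D"
        "mcompl B x \<in> h ` carrier D" "mdia B x \<in> h ` carrier D"
        by simp_all
    }
    have "mbot B = h (mbot D)" "mtop B = h (mtop D)" using h by simp_all
    with D show "mbot B \<in> h ` carrier D" "mtop B \<in> h ` carrier D" by simp_all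
    show "x \<in> carrier B" if "x \<in> h ` carrier D" for x using h that by auto
  qed
  then show ?thesis using assms(3) by simp
qed

lemma subuniverse_self: "subuniverse B U \<Longrightarrow> subuniverse (B\<lparr>carrier := U\<rparr>) U"
  by (simp add: subuniverse_def)

lemma HSP_closed:
  fixes A :: "'a modal_algebra" and B :: "'b modal_algebra"
  shows "B \<in> HSP A \<Longrightarrow> subuniverse B (carrier B)"
proof -
  assume "B \<in> HSP A"
  then obtain I :: "('b \<Rightarrow> 'a) set" and S h where S: "subuniverse (power_algebra A I) S"
    and h: "h \<in> modal_hom (power_algebra A I\<lparr>carrier := S\<rparr>) B" and onto: "h ` S = carrier B"
    unfolding HSP_def by blast
  show ?thesis
    by (rule modal_hom_image_closed[OF _ h]) (use subuniverse_self[OF S] onto in simp_all)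
qed

text \<open>An isomorphic copy, along an injection \<open>f\<close>, of the subalgebra of \<open>B\<close> with carrier \<open>U\<close>.\<close>

definition copy_algebra ::
    "('b \<Rightarrow> 'c) \<Rightarrow> 'b set \<Rightarrow> 'b modal_algebra \<Rightarrow> 'c modal_algebra" where
  "copy_algebra f U B = (let g = inv_into U f in \<lparr>carrier = f ` U,
     mjoin = (\<lambda>x y. f (mjoin B (g x) (g y))), mmeet = (\<lambda>x y. f (mmeet B (g x) (g y))),
     mcompl = (\<lambda>x. f (mcompl B (g x))), mbot = f (mbot B), mtop = f (mtop B),
     mdia = (\<lambda>x. f (mdia B (g x)))\<rparr>)"

lemma copy_algebra_simps:
  assumes "inj_on f U"
  shows "carrier (copy_algebra f U B) = f ` U"
    "mbot (copy_algebra f U B) = f (mbot B)" "mtop (copy_algebra f U B) = f (mtop B)"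
    "x \<in> U \<Longrightarrow> mcompl (copy_algebra f U B) (f x) = f (mcompl B x)"
    "x \<in> U \<Longrightarrow> mdia (copy_algebra f U B) (f x) = f (mdia B x)"
    "x \<in> U \<Longrightarrow> y \<in> U \<Longrightarrow> mjoin (copy_algebra f U B) (f x) (f y) = f (mjoin B x y)"
    "x \<in> U \<Longrightarrow> y \<in> U \<Longrightarrow> mmeet (copy_algebra f U B) (f x) (f y) = f (mmeet B x y)"
  using assms by (simp_all add: copy_algebra_def Let_def)

lemma copy_hom: "inj_on f U \<Longrightarrow> f \<in> modal_hom (B\<lparr>carrier := U\<rparr>) (copy_algebra f U B)"
  by (simp add: modal_hom_def Pi_iff copy_algebra_simps)

lemma modal_hom_comp:
  "h \<in> modal_hom A B \<Longrightarrow> f \<in> modal_hom B C \<Longrightarrow> f \<circ> h \<in> modal_hom A C"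
  by (simp add: modal_hom_def Pi_iff)

lemma copy_in_HSP:
  assumes A: "subuniverse A (carrier A)" and B: "B \<in> HSP A"
    and U: "subuniverse B U" and f: "inj_on f U"
  shows "copy_algebra f U B \<in> HSP A"
proof -
  obtain I :: "('b \<Rightarrow> 'a) set" and S h where S: "subuniverse (power_algebra A I) S"
    and h: "h \<in> modal_hom (power_algebra A I\<lparr>carrier := S\<rparr>) B" and onto: "h ` S = carrier B"
    using B unfolding HSP_def by blast
  define T where "T = {s \<in> S. h s \<in> U}"
  have "subuniverse (power_algebra A I) T"
    using S h U unfolding subuniverse_def modal_hom_def T_def by auto
  moreover have "f \<circ> h \<in> modal_hom (power_algebra A I\<lparr>carrier := T\<rparr>) (copy_algebra f U B)"
  proof (rule modal_hom_comp)
    show "h \<in> modal_hom (power_algebra A I\<lparr>carrier := T\<rparr>) (B\<lparr>carrier := U\<rparr>)"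
      using h unfolding modal_hom_def T_def by (simp add: Pi_iff)
  qed (rule copy_hom[OF f])
  moreover have "(f \<circ> h) ` T = carrier (copy_algebra f U B)"
  proof -
    have "h ` T = U"
    proof
      show "h ` T \<subseteq> U" by (auto simp: T_def)
      show "U \<subseteq> h ` T"
      proof
        fix u assume u: "u \<in> U"
        then have "u \<in> h ` S" using U onto by (auto simp: subuniverse_def)
        then show "u \<in> h ` T" using u by (auto simp: T_def)
      qed
    qed
    then show ?thesis
      by (simp only: copy_algebra_simps(1)[OF f] image_comp[symmetric])
  qed
  ultimately show ?thesis
    by (rule HSP_I[OF A])
qed

lemma eval_term_in:
  assumes "subuniverse B U" "range \<rho> \<subseteq> U"
  shows "eval_term B \<rho> t \<in> U"
  by (induction t) (use assms in \<open>auto simp: subuniverse_def\<close>)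

lemma eval_term_copy:
  assumes "subuniverse B U" "inj_on f U" "range \<rho> \<subseteq> U"
  shows "eval_term (copy_algebra f U B) (f \<circ> \<rho>) t = f (eval_term B \<rho> t)"
  by (induction t) (simp_all add: copy_algebra_simps[OF assms(2)] eval_term_in[OF assms(1,3)])

lemma congruence_Inter:
  assumes "\<C> \<noteq> {}" "\<And>\<theta>. \<theta> \<in> \<C> \<Longrightarrow> congruence B \<theta>"
  shows "congruence B (\<Inter>\<C>)"
proof -
  have e: "equiv (carrier B) \<theta>" if "\<theta> \<in> \<C>" for \<theta>
    using assms(2)[OF that] by (simp add: congruence_def)
  have "equiv (carrier B) (\<Inter>\<C>)"
  proof (rule equivI)
    obtain \<theta> where "\<theta> \<in> \<C>" using assms(1) by blast
    with e[OF this] show "\<Inter>\<C> \<subseteq> carrier B \<times> carrier B"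
      by (auto simp: equiv_def)
    show "refl_on (carrier B) (\<Inter>\<C>)"
      using e by (auto simp: equiv_def refl_on_def)
    show "sym (\<Inter>\<C>)"
      by (rule symI) (use e in \<open>auto simp: equiv_def dest: symD\<close>)
    show "trans (\<Inter>\<C>)"
    proof (rule transI, rule InterI)
      fix x y z \<theta> assume "(x, y) \<in> \<Inter>\<C>" "(y, z) \<in> \<Inter>\<C>" and \<theta>: "\<theta> \<in> \<C>"
      then have "(x, y) \<in> \<theta>" "(y, z) \<in> \<theta>" by auto
      with e[OF \<theta>] show "(x, z) \<in> \<theta>" unfolding equiv_def by (meson transD)
    qed
  qed
  moreover have "(mcompl B x, mcompl B x') \<in> \<theta> \<and> (mdia B x, mdia B x') \<in> \<theta>"
    if "(x, x') \<in> \<Inter>\<C>" "\<theta> \<in> \<C>" for x x' \<theta>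
  proof -
    have "(x, x') \<in> \<theta>" using that by auto
    then show ?thesis using assms(2)[OF that(2)] by (auto simp: congruence_def)
  qed
  moreover have "(mjoin B x y, mjoin B x' y') \<in> \<theta> \<and> (mmeet B x y, mmeet B x' y') \<in> \<theta>"
    if "(x, x') \<in> \<Inter>\<C>" "(y, y') \<in> \<Inter>\<C>" "\<theta> \<in> \<C>" for x x' y y' \<theta>
  proof -
    have "(x, x') \<in> \<theta>" "(y, y') \<in> \<theta>" using that by auto
    then show ?thesis using assms(2)[OF that(3)] unfolding congruence_def by fastforce
  qed
  ultimately show ?thesis
    unfolding congruence_def by (simp add: split_beta)
qed

lemma congruence_total:
  "subuniverse B (carrier B) \<Longrightarrow> congruence B (carrier B \<times> carrier B)"
  by (auto simp: congruence_def subuniverse_def equiv_def refl_on_def sym_def trans_def)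

lemma congruence_principal:
  assumes "subuniverse B (carrier B)" "a \<in> carrier B" "b \<in> carrier B"
  shows "congruence B (principal_congruence B a b)" "(a, b) \<in> principal_congruence B a b"
proof -
  have "carrier B \<times> carrier B \<in> {\<theta>. congruence B \<theta> \<and> (a, b) \<in> \<theta>}"
    using congruence_total[OF assms(1)] assms(2,3) by simp
  then show "congruence B (principal_congruence B a b)"
    unfolding principal_congruence_def by (intro congruence_Inter) auto
  show "(a, b) \<in> principal_congruence B a b"
    by (simp add: principal_congruence_def)
qed

lemma congruence_pullback:
  assumes U: "subuniverse B U" and f: "f \<in> modal_hom (B\<lparr>carrier := U\<rparr>) B'"
    and \<theta>: "congruence B' \<theta>"
  shows "congruence (B\<lparr>carrier := U\<rparr>) {(x, y). x \<in> U \<and> y \<in> U \<and> (f x, f y) \<in> \<theta>}"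
proof -
  have e: "equiv (carrier B') \<theta>" using \<theta> by (simp add: congruence_def)
  have fU: "f x \<in> carrier B'" if "x \<in> U" for x
    using f that by (auto simp: modal_hom_def)
  have "equiv U {(x, y). x \<in> U \<and> y \<in> U \<and> (f x, f y) \<in> \<theta>}"
    using e fU unfolding equiv_def refl_on_def sym_def trans_def by blast
  moreover have "(f x, f x') \<in> \<theta> \<Longrightarrow> (f y, f y') \<in> \<theta> \<Longrightarrow>
      (mjoin B' (f x) (f y), mjoin B' (f x') (f y')) \<in> \<theta> \<and>
      (mmeet B' (f x) (f y), mmeet B' (f x') (f y')) \<in> \<theta>" for x x' y y'
    using \<theta> unfolding congruence_def by blast
  moreover have "(f x, f x') \<in> \<theta> \<Longrightarrow>
      (mcompl B' (f x), mcompl B' (f x')) \<in> \<theta> \<and> (mdia B' (f x), mdia B' (f x')) \<in> \<theta>" for x x'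
    using \<theta> unfolding congruence_def by blast
  ultimately show ?thesis
    using U f unfolding congruence_def subuniverse_def modal_hom_def by auto
qed

lemma principal_congruence_hom:
  assumes U: "subuniverse B U" and f: "f \<in> modal_hom (B\<lparr>carrier := U\<rparr>) B'"
    and ab: "a \<in> U" "b \<in> U"
    and cd: "(c, d) \<in> principal_congruence (B\<lparr>carrier := U\<rparr>) a b"
  shows "(f c, f d) \<in> principal_congruence B' (f a) (f b)"
  using cd congruence_pullback[OF U f] ab unfolding principal_congruence_def by blast

lemma principal_congruence_mono:
  assumes U: "subuniverse B U" and U': "subuniverse B U'" and "U \<subseteq> U'" and ab: "a \<in> U" "b \<in> U"
  shows "principal_congruence (B\<lparr>carrier := U\<rparr>) a b \<subseteq> principal_congruence (B\<lparr>carrier := U'\<rparr>) a b"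
proof -
  have "id \<in> modal_hom (B\<lparr>carrier := U\<rparr>) (B\<lparr>carrier := U'\<rparr>)"
    using \<open>U \<subseteq> U'\<close> by (auto simp: modal_hom_def)
  from principal_congruence_hom[OF U this ab] show ?thesis by auto
qed

lemma principal_congruence_copy:
  assumes U: "subuniverse B U" and f: "inj_on f U"
    and abcd: "a \<in> U" "b \<in> U" "c \<in> U" "d \<in> U"
  shows "(f c, f d) \<in> principal_congruence (copy_algebra f U B) (f a) (f b) \<longleftrightarrow>
    (c, d) \<in> principal_congruence (B\<lparr>carrier := U\<rparr>) a b" (is "?l \<longleftrightarrow> ?r")
proof
  from principal_congruence_hom[OF U copy_hom[OF f]] abcd show "?r \<Longrightarrow> ?l" by blast
next
  assume ?l
  define C where "C = copy_algebra f U B"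
  define g where "g = inv_into U f"
  have gf: "g (f x) = x" if "x \<in> U" for x
    using f that by (simp add: g_def)
  note U' = U[unfolded subuniverse_def]
  have CU: "subuniverse C (carrier C)"
    using U' by (auto simp: subuniverse_def C_def copy_algebra_simps[OF f])
  have CC: "C\<lparr>carrier := carrier C\<rparr> = C" by simp
  have hom: "g \<in> modal_hom (C\<lparr>carrier := carrier C\<rparr>) (B\<lparr>carrier := U\<rparr>)"
    using U' by (auto simp: modal_hom_def C_def copy_algebra_simps[OF f] gf)
  have "(g (f c), g (f d)) \<in> principal_congruence (B\<lparr>carrier := U\<rparr>) (g (f a)) (g (f b))"
  proof (rule principal_congruence_hom[OF CU hom])
    show "f a \<in> carrier C" "f b \<in> carrier C"
      using abcd by (simp_all add: C_def copy_algebra_simps[OF f])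
    show "(f c, f d) \<in> principal_congruence (C\<lparr>carrier := carrier C\<rparr>) (f a) (f b)"
      unfolding CC using \<open>?l\<close> by (simp add: C_def)
  qed
  then show ?r using gf abcd by simp
qed

lemma generated_props:
  assumes "subuniverse B (carrier B)" "K \<subseteq> carrier B"
  shows "subuniverse B (generated B K)" "K \<subseteq> generated B K"
  using assms unfolding generated_def subuniverse_def by blast+

instance modal_term :: (countable) countable
  by countable_datatype

lemma countable_generated:
  assumes B: "subuniverse B (carrier B)" and K: "K \<subseteq> carrier B" "countable K" "K \<noteq> {}"
  shows "countable (generated B K)"
proof -
  define \<rho> where "\<rho> = from_nat_into K"
  have \<rho>: "range \<rho> = K"
    using K by (simp add: \<rho>_def range_from_nat_into)
  have cl: "eval_term B \<rho> t \<in> carrier B" for t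
    by (rule eval_term_in[OF B]) (simp add: \<rho> K)
  have "subuniverse B (range (eval_term B \<rho>))"
    unfolding subuniverse_def
  proof (intro conjI ballI subsetI)
    fix x y assume "x \<in> range (eval_term B \<rho>)" "y \<in> range (eval_term B \<rho>)"
    then obtain s t where st: "x = eval_term B \<rho> s" "y = eval_term B \<rho> t" by blast
    show "mjoin B x y \<in> range (eval_term B \<rho>)"
      by (rule range_eqI[of _ _ "Join s t"]) (simp add: st)
    show "mmeet B x y \<in> range (eval_term B \<rho>)"
      by (rule range_eqI[of _ _ "Meet s t"]) (simp add: st)
  next
    fix x assume "x \<in> range (eval_term B \<rho>)"
    then obtain t where t: "x = eval_term B \<rho> t" by blast
    show "x \<in> carrier B" using cl t by simp
    show "mcompl B x \<in> range (eval_term B \<rho>)"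
      by (rule range_eqI[of _ _ "Compl t"]) (simp add: t)
    show "mdia B x \<in> range (eval_term B \<rho>)"
      by (rule range_eqI[of _ _ "Dia t"]) (simp add: t)
  next
    show "mbot B \<in> range (eval_term B \<rho>)" by (rule range_eqI[of _ _ Bot]) simp
    show "mtop B \<in> range (eval_term B \<rho>)" by (rule range_eqI[of _ _ Top]) simp
  qed
  moreover have "K \<subseteq> range (eval_term B \<rho>)"
  proof
    fix x assume "x \<in> K"
    then obtain n where "x = eval_term B \<rho> (Var n)" using \<rho> by auto
    then show "x \<in> range (eval_term B \<rho>)" by blast
  qed
  ultimately have "generated B K \<subseteq> range (eval_term B \<rho>)"
    unfolding generated_def by blast
  moreover have "countable (UNIV :: nat modal_term set)"
    by simp
  ultimately show ?thesis
    by (meson countable_subset countable_image)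
qed

text \<open>Principal congruences are witnessed in countable subalgebras, so EDPC for the algebras
  carried by subsets of \<^typ>\<open>nat\<close> yields EDPC for the algebras over every type.\<close>

theorem has_EDPC_any_type:
  fixes A :: "'a modal_algebra"
  assumes A: "subuniverse A (carrier A)" and edpc: "has_EDPC (HSP A :: nat modal_algebra set)"
  shows "has_EDPC (HSP A :: 'b modal_algebra set)"
proof -
  obtain P where P: "finite P"
    "\<And>B :: nat modal_algebra. B \<in> HSP A \<Longrightarrow> defines_principal_congruences P B"
    using edpc unfolding has_EDPC_def by blast
  have "defines_principal_congruences P B" if B: "B \<in> HSP A" for B :: "'b modal_algebra"
  proof -
    note BB = HSP_closed[OF B]
    define eqs where "eqs a b c d \<longleftrightarrow> (\<forall>(p, q)\<in>P.
      eval_term B (assign4 a b c d) p = eval_term B (assign4 a b c d) q)" for a b c d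
    have ctbl: "(c, d) \<in> principal_congruence (B\<lparr>carrier := U\<rparr>) a b \<longleftrightarrow> eqs a b c d"
      if U: "subuniverse B U" "countable U" and abcd: "a \<in> U" "b \<in> U" "c \<in> U" "d \<in> U"
      for U a b c d
    proof -
      define f where "f = to_nat_on U"
      have f: "inj_on f U" unfolding f_def using U(2) by (rule inj_on_to_nat_on)
      have rg: "range (assign4 a b c d) \<subseteq> U"
        using abcd by (auto simp: assign4_def split: var4.splits)
      have asg: "assign4 (f a) (f b) (f c) (f d) = f \<circ> assign4 a b c d"
        by (auto simp: assign4_def fun_eq_iff split: var4.splits)
      have "defines_principal_congruences P (copy_algebra f U B)"
        by (rule P(2)[OF copy_in_HSP[OF A B U(1) f]])
      then have "(f c, f d) \<in> principal_congruence (copy_algebra f U B) (f a) (f b) \<longleftrightarrow>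
          (\<forall>(p, q)\<in>P. f (eval_term B (assign4 a b c d) p) = f (eval_term B (assign4 a b c d) q))"
        using abcd unfolding defines_principal_congruences_def
        by (simp add: copy_algebra_simps(1)[OF f] asg eval_term_copy[OF U(1) f rg])
      then show ?thesis
        unfolding principal_congruence_copy[OF U(1) f abcd] eqs_def
        using inj_on_eq_iff[OF f] eval_term_in[OF U(1) rg] by simp
    qed
    have "(c, d) \<in> principal_congruence B a b \<longleftrightarrow> eqs a b c d"
      if abcd: "a \<in> carrier B" "b \<in> carrier B" "c \<in> carrier B" "d \<in> carrier B" for a b c d
    proof
      assume e: "eqs a b c d"
      let ?U = "generated B {a, b, c, d}"
      have U: "subuniverse B ?U" "{a, b, c, d} \<subseteq> ?U" "countable ?U"
        using generated_props[OF BB, of "{a, b, c, d}"]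
          countable_generated[OF BB, of "{a, b, c, d}"] abcd by simp_all
      have "(c, d) \<in> principal_congruence (B\<lparr>carrier := ?U\<rparr>) a b"
        using ctbl[OF U(1,3)] U(2) e by simp
      moreover have "?U \<subseteq> carrier B" using U(1) by (simp add: subuniverse_def)
      ultimately show "(c, d) \<in> principal_congruence B a b"
        using principal_congruence_mono[OF U(1) BB, of a b] U(2) by auto
    next
      assume cd: "(c, d) \<in> principal_congruence B a b"
      define good where "good U \<longleftrightarrow> subuniverse B U \<and> countable U \<and> a \<in> U \<and> b \<in> U" for U
      define Cg where "Cg U = principal_congruence (B\<lparr>carrier := U\<rparr>) a b" for U
      define R where "R = {(x, y). \<exists>U. good U \<and> (x, y) \<in> Cg U}"
      have good_gen: "good (generated B K) \<and> K \<subseteq> generated B K"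
        if "K \<subseteq> carrier B" "countable K" "a \<in> K" "b \<in> K" for K
        using generated_props[OF BB that(1)] countable_generated[OF BB that(1,2)] that
        by (auto simp: good_def)
      have Cg: "congruence (B\<lparr>carrier := U\<rparr>) (Cg U) \<and> (a, b) \<in> Cg U" if "good U" for U
        using congruence_principal[of "B\<lparr>carrier := U\<rparr>" a b] subuniverse_self[of B U] that
        by (simp add: good_def Cg_def)
      have Cg_equiv: "equiv U (Cg U)" if "good U" for U
        using Cg[OF that] by (simp add: congruence_def)
      have common: "\<exists>U. good U \<and> (x, x') \<in> Cg U \<and> (y, y') \<in> Cg U"
        if xy: "(x, x') \<in> R" "(y, y') \<in> R" for x x' y y'
      proof -
        obtain U V where UV: "good U" "(x, x') \<in> Cg U" "good V" "(y, y') \<in> Cg V"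
          using xy by (auto simp: R_def)
        have g: "good (generated B (U \<union> V))" "U \<union> V \<subseteq> generated B (U \<union> V)"
          using good_gen[of "U \<union> V"] UV(1,3) by (auto simp: good_def subuniverse_def)
        have "Cg U \<subseteq> Cg (generated B (U \<union> V))" "Cg V \<subseteq> Cg (generated B (U \<union> V))"
          using principal_congruence_mono[of B _ "generated B (U \<union> V)" a b] UV g
          by (auto simp: good_def Cg_def)
        then show ?thesis using g UV by blast
      qed
      have sub: "R \<subseteq> carrier B \<times> carrier B"
        using Cg_equiv unfolding R_def equiv_def good_def subuniverse_def by blast
      have refl: "(x, x) \<in> R" if "x \<in> carrier B" for x
      proof -
        have "good (generated B {a, b, x})" "x \<in> generated B {a, b, x}"
          using good_gen[of "{a, b, x}"] abcd that by auto
        then show ?thesis using Cg_equiv unfolding R_def equiv_def refl_on_def by blast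
      qed
      have sym: "(y, x) \<in> R" if "(x, y) \<in> R" for x y
        using that Cg_equiv unfolding R_def equiv_def sym_def by blast
      have trans: "(x, z) \<in> R" if xyz: "(x, y) \<in> R" "(y, z) \<in> R" for x y z
      proof -
        obtain U where "good U" "(x, y) \<in> Cg U" "(y, z) \<in> Cg U"
          using common[OF xyz] by blast
        moreover from this have "(x, z) \<in> Cg U"
          using Cg_equiv[of U] unfolding equiv_def trans_def by blast
        ultimately show ?thesis by (auto simp: R_def)
      qed
      have "equiv (carrier B) R"
      proof (rule equivI)
        show "R \<subseteq> carrier B \<times> carrier B" by (rule sub)
        show "refl_on (carrier B) R" by (rule refl_onI) (rule refl)
        show "sym R" by (rule symI) (rule sym)
        show "trans R" by (rule transI) (rule trans)
      qed
      moreover have "(mcompl B x, mcompl B x') \<in> R \<and> (mdia B x, mdia B x') \<in> R"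
        if xx: "(x, x') \<in> R" for x x'
      proof -
        obtain U where "good U" "(x, x') \<in> Cg U" using xx by (auto simp: R_def)
        moreover from this have "(mcompl B x, mcompl B x') \<in> Cg U \<and> (mdia B x, mdia B x') \<in> Cg U"
          using Cg[of U] unfolding congruence_def by auto
        ultimately show ?thesis by (auto simp: R_def)
      qed
      moreover have "(mjoin B x y, mjoin B x' y') \<in> R \<and> (mmeet B x y, mmeet B x' y') \<in> R"
        if xy: "(x, x') \<in> R" "(y, y') \<in> R" for x x' y y'
      proof -
        obtain U where U: "good U" "(x, x') \<in> Cg U" "(y, y') \<in> Cg U" using common[OF xy] by blast
        then have "(mjoin B x y, mjoin B x' y') \<in> Cg U \<and> (mmeet B x y, mmeet B x' y') \<in> Cg U"
          using Cg[of U] unfolding congruence_def by fastforce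
        with U show ?thesis by (auto simp: R_def)
      qed
      ultimately have "congruence B R" unfolding congruence_def by blast
      moreover have "(a, b) \<in> R"
        using good_gen[of "{a, b}"] abcd Cg by (auto simp: R_def)
      ultimately have "(c, d) \<in> R" using cd unfolding principal_congruence_def by blast
      then obtain U where U: "good U" "(c, d) \<in> Cg U" by (auto simp: R_def)
      moreover from this have "c \<in> U" "d \<in> U" using Cg_equiv[of U] unfolding equiv_def by auto
      ultimately show "eqs a b c d" using ctbl[of U a b c d] by (simp add: good_def Cg_def)
    qed
    then show ?thesis unfolding defines_principal_congruences_def eqs_def by blast
  qed
  with P(1) show ?thesis unfolding has_EDPC_def by blast
qed

end

theory Submission
  imports Defs
begin

text \<open>
  EDPC bounds the number of boxes needed to generate an open filter: there is an \<open>n\<close> such that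
  \<open>a \<and> \<box>a \<and> \<dots> \<and> \<box>\<^sup>n a\<close> is open (lies below its own box) for every \<open>a\<close>. Since \<open>A\<close> is finitely
  generated, congruences of finite index are finitely generated; hence each of them has the form
  \<open>x \<and> u = y \<and> u\<close> for an open element \<open>u\<close> with finitely many elements below it. By residual
  finiteness these elements \<open>u\<close> separate points. A member of the profinite completion is then a
  coherent choice of elements below the various \<open>u\<close>, and the element \<open>p\<close> chosen below \<open>u\<close>
  approximates it from below by \<open>p\<close> and from above by \<open>p \<or> \<not>u\<close>; this gives both densities.
  Smoothness holds because openness of \<open>u\<close> gives \<open>u \<and> \<diamond>(p \<or> \<not>u) \<le> \<diamond>p\<close>.
\<close>

section \<open>Boolean algebra and the modal operators\<close>

text \<open>The obstacle is that a finitely generated open filter need not be principal: closing an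
  element \<open>a\<close> under box can give an endlessly descending sequence
  \<open>box_iter k a\<close>. EDPC stops the descent after a number of steps that does not depend
  on \<open>a\<close>, and therefore the class of top modulo a congruence of finite index has a
  least element \<open>u\<close>. This one element determines the congruence, and computations with
  classes become computations with elements below \<open>u\<close>. Finiteness of the interval below
  \<open>u\<close> takes over the role of infinite joins: every lattice ideal of \<open>A\<close>
  has a member below \<open>u\<close> that bounds the restrictions to \<open>u\<close> of all its
  members. This yields infima in the profinite completion, and in an arbitrary MacNeille completion
  it yields an element of \<open>A\<close> that pins a given point down up to \<open>u\<close>.
  Hence smoothness needs only the two densities and no description of the completion.\<close>

context modal_algebra
begin

abbreviation join (infixl "\<curlyvee>" 65) where "x \<curlyvee> y \<equiv> mjoin A x y"
abbreviation meet (infixl "\<curlywedge>" 70) where "x \<curlywedge> y \<equiv> mmeet A x y"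
abbreviation neg ("\<sim> _" [81] 80) where "\<sim> x \<equiv> mcompl A x"
abbreviation leq (infix "\<preceq>" 50) where "x \<preceq> y \<equiv> mjoin A x y = y"

definition box :: "'a \<Rightarrow> 'a" where "box x = \<sim> (mdia A (\<sim> x))"

lemma op_closed [simp, intro]:
  "mbot A \<in> carrier A" "mtop A \<in> carrier A"
  "x \<in> carrier A \<Longrightarrow> \<sim> x \<in> carrier A"
  "x \<in> carrier A \<Longrightarrow> mdia A x \<in> carrier A"
  "x \<in> carrier A \<Longrightarrow> y \<in> carrier A \<Longrightarrow> x \<curlyvee> y \<in> carrier A"
  "x \<in> carrier A \<Longrightarrow> y \<in> carrier A \<Longrightarrow> x \<curlywedge> y \<in> carrier A"
  using closed by (auto simp: subuniverse_def)

lemma box_closed [simp, intro]: "x \<in> carrier A \<Longrightarrow> box x \<in> carrier A"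
  by (simp add: box_def)

lemma join_idem: "x \<in> carrier A \<Longrightarrow> x \<curlyvee> x = x"
  by (metis join_absorb meet_absorb op_closed(5))

lemma meet_idem: "x \<in> carrier A \<Longrightarrow> x \<curlywedge> x = x"
  by (metis join_absorb meet_absorb op_closed(6))

lemma meet_left_comm:
  "x \<in> carrier A \<Longrightarrow> y \<in> carrier A \<Longrightarrow> z \<in> carrier A \<Longrightarrow> x \<curlywedge> (y \<curlywedge> z) = y \<curlywedge> (x \<curlywedge> z)"
  using meet_assoc[of x y z] meet_assoc[of y x z] meet_comm[of x y] by simp

lemma leq_iff_meet: "x \<in> carrier A \<Longrightarrow> y \<in> carrier A \<Longrightarrow> x \<preceq> y \<longleftrightarrow> x \<curlywedge> y = x"
  by (metis join_absorb meet_absorb join_comm meet_comm)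

lemma leq_trans:
  "x \<preceq> y \<Longrightarrow> y \<preceq> z \<Longrightarrow> x \<in> carrier A \<Longrightarrow> y \<in> carrier A \<Longrightarrow> z \<in> carrier A \<Longrightarrow> x \<preceq> z"
  by (metis join_assoc)

lemma leq_antisym: "x \<preceq> y \<Longrightarrow> y \<preceq> x \<Longrightarrow> x \<in> carrier A \<Longrightarrow> y \<in> carrier A \<Longrightarrow> x = y"
  by (metis join_comm)

lemma join_upper:
  assumes "x \<in> carrier A" "y \<in> carrier A"
  shows "x \<preceq> x \<curlyvee> y" "y \<preceq> x \<curlyvee> y"
  using assms by (metis join_assoc join_idem, metis join_assoc join_comm join_idem)

lemma join_least:
  "x \<preceq> z \<Longrightarrow> y \<preceq> z \<Longrightarrow> x \<in> carrier A \<Longrightarrow> y \<in> carrier A \<Longrightarrow> z \<in> carrier A \<Longrightarrow> x \<curlyvee> y \<preceq> z"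
  by (simp add: join_assoc)

lemma meet_lower:
  assumes "x \<in> carrier A" "y \<in> carrier A"
  shows "x \<curlywedge> y \<preceq> x" "x \<curlywedge> y \<preceq> y"
  using assms by (metis join_absorb join_comm op_closed(6), metis join_absorb join_comm meet_comm op_closed(6))

lemma meet_greatest:
  "z \<preceq> x \<Longrightarrow> z \<preceq> y \<Longrightarrow> x \<in> carrier A \<Longrightarrow> y \<in> carrier A \<Longrightarrow> z \<in> carrier A \<Longrightarrow> z \<preceq> x \<curlywedge> y"
  by (metis leq_iff_meet meet_assoc op_closed(6))

lemma leq_meet_iff:
  "x \<in> carrier A \<Longrightarrow> y \<in> carrier A \<Longrightarrow> z \<in> carrier A \<Longrightarrow> z \<preceq> x \<curlywedge> y \<longleftrightarrow> z \<preceq> x \<and> z \<preceq> y"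
  by (metis leq_trans meet_greatest meet_lower op_closed(6))

lemma join_leq_iff:
  "x \<in> carrier A \<Longrightarrow> y \<in> carrier A \<Longrightarrow> z \<in> carrier A \<Longrightarrow> x \<curlyvee> y \<preceq> z \<longleftrightarrow> x \<preceq> z \<and> y \<preceq> z"
  by (metis leq_trans join_least join_upper op_closed(5))

lemma meet_mono:
  assumes "x \<preceq> x'" "y \<preceq> y'"
    and "x \<in> carrier A" "x' \<in> carrier A" "y \<in> carrier A" "y' \<in> carrier A"
  shows "x \<curlywedge> y \<preceq> x' \<curlywedge> y'"
proof (rule meet_greatest)
  show "x \<curlywedge> y \<preceq> x'" using assms by (intro leq_trans[OF meet_lower(1) assms(1)]) simp_all
  show "x \<curlywedge> y \<preceq> y'" using assms by (intro leq_trans[OF meet_lower(2) assms(2)]) simp_all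
qed (use assms in simp_all)

lemma join_mono:
  assumes "x \<preceq> x'" "y \<preceq> y'"
    and "x \<in> carrier A" "x' \<in> carrier A" "y \<in> carrier A" "y' \<in> carrier A"
  shows "x \<curlyvee> y \<preceq> x' \<curlyvee> y'"
proof (rule join_least)
  show "x \<preceq> x' \<curlyvee> y'" using assms by (intro leq_trans[OF assms(1) join_upper(1)]) simp_all
  show "y \<preceq> x' \<curlyvee> y'" using assms by (intro leq_trans[OF assms(2) join_upper(2)]) simp_all
qed (use assms in simp_all)

lemma bot_leq: "x \<in> carrier A \<Longrightarrow> mbot A \<preceq> x"
  by (metis meet_compl meet_lower(1) op_closed(3))

lemma leq_top: "x \<in> carrier A \<Longrightarrow> x \<preceq> mtop A"
  by (metis join_compl join_upper(1) op_closed(3))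

lemma meet_top: "x \<in> carrier A \<Longrightarrow> x \<curlywedge> mtop A = x"
  using leq_iff_meet leq_top by auto

lemma meet_bot: "x \<in> carrier A \<Longrightarrow> x \<curlywedge> mbot A = mbot A"
  by (metis bot_leq leq_iff_meet meet_comm op_closed(1))

lemma join_bot: "x \<in> carrier A \<Longrightarrow> x \<curlyvee> mbot A = x"
  by (metis bot_leq join_comm op_closed(1))

lemma join_meet_distrib_right:
  "x \<in> carrier A \<Longrightarrow> y \<in> carrier A \<Longrightarrow> z \<in> carrier A \<Longrightarrow> (x \<curlyvee> y) \<curlywedge> z = (x \<curlywedge> z) \<curlyvee> (y \<curlywedge> z)"
  by (metis meet_comm meet_join_distrib op_closed(5))

lemma split_by:
  assumes "x \<in> carrier A" "y \<in> carrier A"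
  shows "x = (x \<curlywedge> y) \<curlyvee> (x \<curlywedge> \<sim> y)"
  using assms by (metis join_compl meet_join_distrib meet_top op_closed(3))

text \<open>Split \<open>x\<close> along \<open>y\<close>: one part is controlled by
  \<open>z\<close>, the other lies below \<open>\<sim> y\<close>. Thus
  \<open>z \<curlyvee> \<sim> y\<close> is the largest element whose meet with \<open>y\<close> is
  below \<open>z\<close>, which is why it serves as the approximation from above.\<close>

lemma residuation:
  assumes "x \<in> carrier A" "y \<in> carrier A" "z \<in> carrier A"
  shows "x \<curlywedge> y \<preceq> z \<longleftrightarrow> x \<preceq> z \<curlyvee> \<sim> y"
proof
  assume l: "x \<curlywedge> y \<preceq> z"
  have "x \<curlywedge> y \<preceq> z \<curlyvee> \<sim> y" using assms by (intro leq_trans[OF l join_upper(1)]) simp_all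
  moreover have "x \<curlywedge> \<sim> y \<preceq> z \<curlyvee> \<sim> y"
    using assms by (intro leq_trans[OF meet_lower(2) join_upper(2)]) simp_all
  ultimately show "x \<preceq> z \<curlyvee> \<sim> y"
    using assms join_least[of "x \<curlywedge> y" "z \<curlyvee> \<sim> y" "x \<curlywedge> \<sim> y"] split_by[of x y] by simp
next
  assume r: "x \<preceq> z \<curlyvee> \<sim> y"
  have "x \<curlywedge> y \<preceq> (z \<curlyvee> \<sim> y) \<curlywedge> y"
    using r assms by (intro meet_mono) (simp_all add: join_idem)
  moreover have "(z \<curlyvee> \<sim> y) \<curlywedge> y = z \<curlywedge> y"
    using assms
    by (simp add: join_meet_distrib_right join_bot meet_comm[of "\<sim> y" y] meet_compl)
  ultimately show "x \<curlywedge> y \<preceq> z"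
    using assms leq_trans[OF _ meet_lower(1), of "x \<curlywedge> y" z y] by simp
qed

lemma leq_neg_iff:
  assumes "x \<in> carrier A" "y \<in> carrier A"
  shows "x \<preceq> \<sim> y \<longleftrightarrow> x \<curlywedge> y = mbot A"
proof -
  have "x \<preceq> \<sim> y \<longleftrightarrow> x \<curlywedge> y \<preceq> mbot A"
    using residuation[of x y "mbot A"] assms by (simp add: bot_leq)
  then show ?thesis using assms by (simp add: join_bot)
qed

section \<open>Agreement of two elements below a third\<close>

lemma meet_eqI:
  assumes "x \<in> carrier A" "y \<in> carrier A" "u \<in> carrier A"
    and "x \<curlywedge> u \<preceq> y" "y \<curlywedge> u \<preceq> x"
  shows "x \<curlywedge> u = y \<curlywedge> u"
proof (rule leq_antisym)
  show "x \<curlywedge> u \<preceq> y \<curlywedge> u" using assms by (intro meet_greatest) (simp_all add: meet_lower)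
  show "y \<curlywedge> u \<preceq> x \<curlywedge> u" using assms by (intro meet_greatest) (simp_all add: meet_lower)
qed (use assms in simp_all)

lemma meet_eq_mono:
  assumes "x \<curlywedge> u = y \<curlywedge> u" "v \<preceq> u"
    and "x \<in> carrier A" "y \<in> carrier A" "u \<in> carrier A" "v \<in> carrier A"
  shows "x \<curlywedge> v = y \<curlywedge> v"
proof -
  have "u \<curlywedge> v = v" using assms by (metis leq_iff_meet meet_comm)
  then show ?thesis using assms meet_assoc[of x u v] meet_assoc[of y u v] by simp
qed

lemma meet_eq_neg:
  assumes "x \<curlywedge> u = y \<curlywedge> u" "x \<in> carrier A" "y \<in> carrier A" "u \<in> carrier A"
  shows "\<sim> x \<curlywedge> u = \<sim> y \<curlywedge> u"
proof -
  have "\<sim> x \<curlywedge> u \<preceq> \<sim> y" if e: "x \<curlywedge> u = y \<curlywedge> u" and c: "x \<in> carrier A" "y \<in> carrier A" for x y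
  proof -
    have "(\<sim> x \<curlywedge> u) \<curlywedge> y = \<sim> x \<curlywedge> (x \<curlywedge> u)"
      using e c assms(4) by (simp add: meet_assoc meet_comm[of u y])
    also have "\<dots> = (x \<curlywedge> \<sim> x) \<curlywedge> u"
      using c assms(4) by (simp add: meet_assoc meet_left_comm[of "\<sim> x" x u])
    also have "\<dots> = mbot A"
      using c assms(4) by (metis bot_leq leq_iff_meet meet_compl op_closed(1))
    finally show ?thesis using c assms(4) by (simp add: leq_neg_iff)
  qed
  then show ?thesis using assms by (intro meet_eqI) auto
qed

lemma meet_eq_meet:
  assumes "x \<curlywedge> u = x' \<curlywedge> u" "y \<curlywedge> u = y' \<curlywedge> u"
    and "x \<in> carrier A" "x' \<in> carrier A" "y \<in> carrier A" "y' \<in> carrier A" "u \<in> carrier A"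
  shows "(x \<curlywedge> y) \<curlywedge> u = (x' \<curlywedge> y') \<curlywedge> u"
proof -
  have "(x \<curlywedge> y) \<curlywedge> u = y' \<curlywedge> (x \<curlywedge> u)"
    using assms by (simp add: meet_assoc meet_left_comm[of x y' u])
  then show ?thesis using assms by (simp add: meet_assoc meet_left_comm[of x' y' u])
qed

lemma meet_eq_join:
  assumes "x \<curlywedge> u = x' \<curlywedge> u" "y \<curlywedge> u = y' \<curlywedge> u"
    and "x \<in> carrier A" "x' \<in> carrier A" "y \<in> carrier A" "y' \<in> carrier A" "u \<in> carrier A"
  shows "(x \<curlyvee> y) \<curlywedge> u = (x' \<curlyvee> y') \<curlywedge> u"
  using assms by (simp add: join_meet_distrib_right)

section \<open>Diamond, box and agreement below an element\<close>

lemma dia_mono: "x \<preceq> y \<Longrightarrow> x \<in> carrier A \<Longrightarrow> y \<in> carrier A \<Longrightarrow> mdia A x \<preceq> mdia A y"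
  by (metis dia_join)

lemma neg_antimono:
  "x \<preceq> y \<Longrightarrow> x \<in> carrier A \<Longrightarrow> y \<in> carrier A \<Longrightarrow> \<sim> y \<preceq> \<sim> x"
proof -
  assume xy: "x \<preceq> y" and c: "x \<in> carrier A" "y \<in> carrier A"
  then have "\<sim> y \<curlywedge> x = (x \<curlywedge> y) \<curlywedge> \<sim> y" by (simp add: leq_iff_meet meet_comm)
  also have "\<dots> = mbot A" using c by (simp add: meet_assoc meet_compl meet_bot)
  finally show ?thesis using c by (simp add: leq_neg_iff)
qed

lemma neg_neg:
  assumes "x \<in> carrier A"
  shows "\<sim> (\<sim> x) = x"
proof (rule leq_antisym)
  show "x \<preceq> \<sim> (\<sim> x)" using assms by (simp add: leq_neg_iff meet_compl)
  have "\<sim> (\<sim> x) \<curlywedge> \<sim> x = mbot A" using assms by (metis meet_comm meet_compl op_closed(3))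
  then have "\<sim> (\<sim> x) \<curlywedge> x = \<sim> (\<sim> x)"
    using split_by[of "\<sim> (\<sim> x)" x] assms by (simp add: join_bot)
  then show "\<sim> (\<sim> x) \<preceq> x" using assms by (simp add: leq_iff_meet)
qed (use assms in simp_all)

lemma box_mono: "x \<preceq> y \<Longrightarrow> x \<in> carrier A \<Longrightarrow> y \<in> carrier A \<Longrightarrow> box x \<preceq> box y"
  by (simp add: box_def dia_mono neg_antimono)

text \<open>Splitting \<open>x\<close> along \<open>v\<close> splits its diamond, and the part
  coming from outside \<open>v\<close> lies below \<open>mdia A (\<sim> v)\<close>, the complement
  of \<open>box v\<close>.\<close>

lemma dia_meet_box:
  assumes "x \<in> carrier A" "v \<in> carrier A"
  shows "mdia A x \<curlywedge> box v \<preceq> mdia A (x \<curlywedge> v)"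
proof -
  have "mdia A x = mdia A (x \<curlywedge> v) \<curlyvee> mdia A (x \<curlywedge> \<sim> v)"
    using split_by[of x v] dia_join[of "x \<curlywedge> v" "x \<curlywedge> \<sim> v"] assms by simp
  moreover have "mdia A (x \<curlywedge> \<sim> v) \<preceq> mdia A (\<sim> v)"
    using assms by (intro dia_mono) (simp_all add: meet_lower)
  ultimately have "mdia A x \<preceq> mdia A (x \<curlywedge> v) \<curlyvee> mdia A (\<sim> v)"
    using assms join_mono[of "mdia A (x \<curlywedge> v)" "mdia A (x \<curlywedge> v)"] by (simp add: join_idem)
  moreover have "mdia A (\<sim> v) = \<sim> box v"
    using assms by (simp add: box_def neg_neg)
  ultimately show ?thesis
    using assms by (simp add: residuation)
qed

text \<open>Passing through a diamond costs one box: agreement below \<open>v\<close> is carried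
  over to whatever lies below \<open>box v\<close>. Keeping \<open>u\<close> and \<open>v\<close>
  apart lets the lemma serve both open elements (\<open>u = v\<close>) and consecutive members of
  the sequence \<open>box_iter k a\<close>.\<close>

lemma meet_eq_dia:
  assumes "x \<curlywedge> v = y \<curlywedge> v" "u \<preceq> box v"
    and "x \<in> carrier A" "y \<in> carrier A" "u \<in> carrier A" "v \<in> carrier A"
  shows "mdia A x \<curlywedge> u = mdia A y \<curlywedge> u"
proof -
  have "mdia A x \<curlywedge> u \<preceq> mdia A y"
    if e: "x \<curlywedge> v = y \<curlywedge> v" and c: "x \<in> carrier A" "y \<in> carrier A" for x y
  proof -
    have "mdia A x \<curlywedge> u \<preceq> mdia A x \<curlywedge> box v"
      using c assms by (intro meet_mono) (simp_all add: join_idem)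
    moreover have "mdia A x \<curlywedge> box v \<preceq> mdia A (y \<curlywedge> v)"
      using dia_meet_box[of x v] e c assms by simp
    moreover have "mdia A (y \<curlywedge> v) \<preceq> mdia A y"
      using c assms by (intro dia_mono) (simp_all add: meet_lower)
    ultimately show ?thesis
      using c assms
      using leq_trans[of "mdia A x \<curlywedge> u" "mdia A x \<curlywedge> box v" "mdia A y"]
        leq_trans[of "mdia A x \<curlywedge> box v" "mdia A (y \<curlywedge> v)" "mdia A y"] by simp
  qed
  then show ?thesis using assms by (intro meet_eqI) auto
qed

lemma finite_directed_has_max:
  assumes "finite F" "F \<noteq> {}" "F \<subseteq> carrier A" "\<And>x y. x \<in> F \<Longrightarrow> y \<in> F \<Longrightarrow> x \<curlyvee> y \<in> F"
  shows "\<exists>m\<in>F. \<forall>x\<in>F. x \<preceq> m"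
proof -
  \<comment> \<open>The induction runs over subsets \<open>G\<close> while the bound stays in
    \<open>F\<close>, because a subset of \<open>F\<close> need not be closed under joins.\<close>
  have "\<exists>m\<in>F. \<forall>x\<in>G. x \<preceq> m" if "finite G" "G \<subseteq> F" for G
    using that
  proof (induction G rule: finite_induct)
    case (insert a G)
    then obtain m where m: "m \<in> F" "\<forall>x\<in>G. x \<preceq> m" by auto
    have "\<forall>x\<in>insert a G. x \<preceq> a \<curlyvee> m"
    proof
      fix x assume x: "x \<in> insert a G"
      have c: "a \<in> carrier A" "m \<in> carrier A" "x \<in> carrier A"
        using m insert.prems assms(3) x by auto
      show "x \<preceq> a \<curlyvee> m"
      proof (cases "x = a")
        case False
        then have "x \<preceq> m" using m x by blast
        then show ?thesis using c by (intro leq_trans[OF _ join_upper(2)]) simp_all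
      qed (use c in \<open>simp add: join_upper\<close>)
    qed
    then show ?case using m insert.prems assms(4) by blast
  qed (use assms in auto)
  then show ?thesis using assms(1) by blast
qed

section \<open>Congruences and EDPC\<close>

text \<open>Box preserves meets, so this is the meet of \<open>a\<close>, \<open>box a\<close> and
  so on up to \<open>k\<close> boxes. In the nested form, and since every value lies below
  \<open>a\<close>, stabilization at \<open>n\<close> says exactly that the value at
  \<open>n\<close> is open.\<close>

primrec box_iter :: "nat \<Rightarrow> 'a \<Rightarrow> 'a" where
  "box_iter 0 a = a"
| "box_iter (Suc k) a = a \<curlywedge> box (box_iter k a)"

lemma box_iter_closed [simp, intro]: "a \<in> carrier A \<Longrightarrow> box_iter k a \<in> carrier A"
  by (induction k) auto

lemma box_iter_Suc_leq:
  assumes "a \<in> carrier A"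
  shows "box_iter (Suc k) a \<preceq> box_iter k a"
proof (induction k)
  case 0
  show ?case using assms by (simp add: meet_lower)
next
  case (Suc k)
  have "a \<curlywedge> box (box_iter (Suc k) a) \<preceq> a \<curlywedge> box (box_iter k a)"
    by (intro meet_mono box_mono Suc.IH join_idem) (use assms in auto)
  then show ?case by simp
qed

lemma box_iter_antimono:
  assumes "a \<in> carrier A" "k \<le> l"
  shows "box_iter l a \<preceq> box_iter k a"
  using assms(2)
proof (induction l rule: dec_induct)
  case (step l)
  from leq_trans[OF box_iter_Suc_leq step.IH] show ?case
    using assms(1) by (simp del: box_iter.simps)
qed (use assms(1) in \<open>simp add: join_idem\<close>)

lemma neg_top: "\<sim> (mtop A) = mbot A"
  using meet_compl[of "mtop A"] meet_top[of "\<sim> (mtop A)"] meet_comm[of "mtop A" "\<sim> (mtop A)"] by simp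

lemma neg_bot: "\<sim> (mbot A) = mtop A"
  using neg_neg[of "mtop A"] by (simp add: neg_top)

lemma box_top: "box (mtop A) = mtop A"
  by (simp add: box_def neg_top neg_bot dia_bot)

lemma congruenceD:
  assumes "congruence A \<theta>"
  shows "(x, y) \<in> \<theta> \<Longrightarrow> x \<in> carrier A \<and> y \<in> carrier A"
    and "x \<in> carrier A \<Longrightarrow> (x, x) \<in> \<theta>"
    and "(x, y) \<in> \<theta> \<Longrightarrow> (y, x) \<in> \<theta>"
    and "(x, y) \<in> \<theta> \<Longrightarrow> (y, z) \<in> \<theta> \<Longrightarrow> (x, z) \<in> \<theta>"
    and "(x, x') \<in> \<theta> \<Longrightarrow> (\<sim> x, \<sim> x') \<in> \<theta>"
    and "(x, x') \<in> \<theta> \<Longrightarrow> (mdia A x, mdia A x') \<in> \<theta>"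
    and "(x, x') \<in> \<theta> \<Longrightarrow> (y, y') \<in> \<theta> \<Longrightarrow> (x \<curlyvee> y, x' \<curlyvee> y') \<in> \<theta>"
    and "(x, x') \<in> \<theta> \<Longrightarrow> (y, y') \<in> \<theta> \<Longrightarrow> (x \<curlywedge> y, x' \<curlywedge> y') \<in> \<theta>"
proof -
  have e: "equiv (carrier A) \<theta>" using assms by (simp add: congruence_def)
  show "(x, y) \<in> \<theta> \<Longrightarrow> x \<in> carrier A \<and> y \<in> carrier A" "x \<in> carrier A \<Longrightarrow> (x, x) \<in> \<theta>"
    "(x, y) \<in> \<theta> \<Longrightarrow> (y, x) \<in> \<theta>" "(x, y) \<in> \<theta> \<Longrightarrow> (y, z) \<in> \<theta> \<Longrightarrow> (x, z) \<in> \<theta>"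
    using e by (auto simp: equiv_def refl_on_def dest: symD transD)
  have "\<forall>(x, x')\<in>\<theta>. (\<sim> x, \<sim> x') \<in> \<theta> \<and> (mdia A x, mdia A x') \<in> \<theta>"
    using assms by (simp add: congruence_def)
  then show "(x, x') \<in> \<theta> \<Longrightarrow> (\<sim> x, \<sim> x') \<in> \<theta>" "(x, x') \<in> \<theta> \<Longrightarrow> (mdia A x, mdia A x') \<in> \<theta>"
    by blast+
  have "\<forall>(x, x')\<in>\<theta>. \<forall>(y, y')\<in>\<theta>. (x \<curlyvee> y, x' \<curlyvee> y') \<in> \<theta> \<and> (x \<curlywedge> y, x' \<curlywedge> y') \<in> \<theta>"
    using assms by (simp add: congruence_def)
  then show "(x, x') \<in> \<theta> \<Longrightarrow> (y, y') \<in> \<theta> \<Longrightarrow> (x \<curlyvee> y, x' \<curlyvee> y') \<in> \<theta>"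
    "(x, x') \<in> \<theta> \<Longrightarrow> (y, y') \<in> \<theta> \<Longrightarrow> (x \<curlywedge> y, x' \<curlywedge> y') \<in> \<theta>"
    by blast+
qed

text \<open>Top is its own box, so its class is closed under box as well as under meets.\<close>

lemma box_iter_congruent_top:
  assumes "congruence A \<theta>" "(a, mtop A) \<in> \<theta>"
  shows "(box_iter k a, mtop A) \<in> \<theta>"
proof (induction k)
  case (Suc k)
  have "(box (box_iter k a), box (mtop A)) \<in> \<theta>"
    unfolding box_def by (intro congruenceD(5,6)[OF assms(1)] Suc)
  from congruenceD(8)[OF assms(1) assms(2) this] show ?case
    by (simp add: box_top meet_idem)
qed (use assms in simp)

text \<open>Agreement below some \<open>box_iter k a\<close> is a congruence relating
  \<open>a\<close> to top, so it contains the principal one. Agreement of \<open>b\<close> with top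
  below an element means that \<open>b\<close> lies above that element.\<close>

lemma principal_congruence_top_imp:
  assumes a: "a \<in> carrier A" and b: "(b, mtop A) \<in> principal_congruence A a (mtop A)"
  shows "\<exists>k. box_iter k a \<preceq> b"
proof -
  define R where "R = {(x, y). x \<in> carrier A \<and> y \<in> carrier A \<and>
    (\<exists>k. x \<curlywedge> box_iter k a = y \<curlywedge> box_iter k a)}"
  \<comment> \<open>The sequence descends, so agreements at indices \<open>k\<close> and
    \<open>l\<close> both hold at the larger one. Transitivity and the binary operations rest on
    this.\<close>
  have common: "\<exists>k. x \<curlywedge> box_iter k a = x' \<curlywedge> box_iter k a \<and> y \<curlywedge> box_iter k a = y' \<curlywedge> box_iter k a"
    if "(x, x') \<in> R" "(y, y') \<in> R" for x x' y y'
  proof -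
    obtain k l where kl: "x \<curlywedge> box_iter k a = x' \<curlywedge> box_iter k a" "y \<curlywedge> box_iter l a = y' \<curlywedge> box_iter l a"
      and c: "x \<in> carrier A" "x' \<in> carrier A" "y \<in> carrier A" "y' \<in> carrier A"
      using \<open>(x, x') \<in> R\<close> \<open>(y, y') \<in> R\<close> by (auto simp: R_def)
    have "box_iter (max k l) a \<preceq> box_iter k a" "box_iter (max k l) a \<preceq> box_iter l a"
      using a by (simp_all add: box_iter_antimono)
    with meet_eq_mono[OF kl(1)] meet_eq_mono[OF kl(2)] c a show ?thesis
      by (intro exI[of _ "max k l"]) simp
  qed
  have "congruence A R"
    unfolding congruence_def
  proof (intro conjI)
    have "(x, z) \<in> R" if "(x, y) \<in> R" "(y, z) \<in> R" for x y z
      using common[OF that] that by (auto simp: R_def)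
    then have "trans R" by (blast intro: transI)
    moreover have "sym R" by (rule symI) (auto simp: R_def intro: sym)
    ultimately show "equiv (carrier A) R"
      by (intro equivI refl_onI) (auto simp: R_def)
    have "(\<sim> x, \<sim> x') \<in> R \<and> (mdia A x, mdia A x') \<in> R" if xx: "(x, x') \<in> R" for x x'
    proof -
      obtain k where k: "x \<curlywedge> box_iter k a = x' \<curlywedge> box_iter k a"
        and c: "x \<in> carrier A" "x' \<in> carrier A" using xx by (auto simp: R_def)
      \<comment> \<open>The index rises because \<open>box_iter (Suc k) a\<close> lies below the box
        of \<open>box_iter k a\<close>.\<close>
      have "mdia A x \<curlywedge> box_iter (Suc k) a = mdia A x' \<curlywedge> box_iter (Suc k) a"
        using a c by (intro meet_eq_dia[OF k]) (simp_all add: meet_lower)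
      moreover have "\<sim> x \<curlywedge> box_iter k a = \<sim> x' \<curlywedge> box_iter k a"
        using a c by (intro meet_eq_neg[OF k]) simp_all
      ultimately show ?thesis using c unfolding R_def by blast
    qed
    then show "\<forall>(x, x')\<in>R. (\<sim> x, \<sim> x') \<in> R \<and> (mdia A x, mdia A x') \<in> R" by blast
    have "(x \<curlyvee> y, x' \<curlyvee> y') \<in> R \<and> (x \<curlywedge> y, x' \<curlywedge> y') \<in> R"
      if xy: "(x, x') \<in> R" "(y, y') \<in> R" for x x' y y'
    proof -
      obtain k where k: "x \<curlywedge> box_iter k a = x' \<curlywedge> box_iter k a" "y \<curlywedge> box_iter k a = y' \<curlywedge> box_iter k a"
        using common[OF xy] by blast
      have c: "x \<in> carrier A" "x' \<in> carrier A" "y \<in> carrier A" "y' \<in> carrier A"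
        using xy by (auto simp: R_def)
      show ?thesis
        using meet_eq_join[OF k] meet_eq_meet[OF k] c a unfolding R_def by blast
    qed
    then show "\<forall>(x, x')\<in>R. \<forall>(y, y')\<in>R. (x \<curlyvee> y, x' \<curlyvee> y') \<in> R \<and> (x \<curlywedge> y, x' \<curlywedge> y') \<in> R"
      by blast
  qed
  moreover have "(a, mtop A) \<in> R"
    using a meet_comm[of "mtop A" a]
    by (auto simp: R_def meet_top meet_idem intro!: exI[of _ 0])
  ultimately have "(b, mtop A) \<in> R"
    using b unfolding principal_congruence_def by blast
  then obtain k where "b \<in> carrier A" "b \<curlywedge> box_iter k a = mtop A \<curlywedge> box_iter k a"
    by (auto simp: R_def)
  then have "box_iter k a \<preceq> b"
    using a meet_comm[of "mtop A" "box_iter k a"] meet_comm[of "box_iter k a" b]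
    by (simp add: leq_iff_meet meet_top)
  then show ?thesis ..
qed

section \<open>Powers and the uniform bound on boxes\<close>

lemma modal_algebra_power: "modal_algebra (power_algebra A I)"
proof -
  have pt: "f i \<in> carrier A" if "f \<in> carrier (power_algebra A I)" "i \<in> I" for f i
    using that by (auto simp: PiE_iff)
  \<comment> \<open>Absorption returns \<open>x\<close> itself, so there equality must also be
    checked outside \<open>I\<close>. The other laws compare two functions restricted to
    \<open>I\<close>.\<close>
  have out: "f i = undefined" if "f \<in> carrier (power_algebra A I)" "i \<notin> I" for f i
    using that by (auto simp: PiE_iff extensional_def)
  show ?thesis
  proof
    show "subuniverse (power_algebra A I) (carrier (power_algebra A I))"
      by (auto simp: subuniverse_def PiE_iff)
  next
    fix x y assume xy: "x \<in> carrier (power_algebra A I)" "y \<in> carrier (power_algebra A I)"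
    show "mjoin (power_algebra A I) x y = mjoin (power_algebra A I) y x"
      "mmeet (power_algebra A I) x y = mmeet (power_algebra A I) y x"
      using pt[OF xy(1)] pt[OF xy(2)] by (simp_all add: join_comm meet_comm cong: restrict_cong)
    show "mjoin (power_algebra A I) x (mmeet (power_algebra A I) x y) = x"
      "mmeet (power_algebra A I) x (mjoin (power_algebra A I) x y) = x"
      using pt[OF xy(1)] pt[OF xy(2)] out[OF xy(1)] by (auto simp: fun_eq_iff join_absorb meet_absorb)
  qed (auto simp: pt join_assoc meet_assoc meet_join_distrib join_compl meet_compl dia_bot dia_join
      simp del: power_algebra_simps(1) cong: restrict_cong)
qed

lemma power_in_HSP: "power_algebra A I \<in> HSP A"
proof (rule HSP_I[OF closed])
  show "subuniverse (power_algebra A I) (carrier (power_algebra A I))"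
    by (rule modal_algebra.closed[OF modal_algebra_power])
  show "id \<in> modal_hom (power_algebra A I\<lparr>carrier := carrier (power_algebra A I)\<rparr>) (power_algebra A I)"
    by (simp add: modal_hom_def)
qed simp

lemma eval_term_power:
  "eval_term (power_algebra A UNIV) \<rho> t i = eval_term A (\<lambda>v. \<rho> v i) t"
  by (induction t) simp_all

text \<open>A bound on the number of boxes must be uniform: elements \<open>a k\<close> violating it at each \<open>k\<close>
  would assemble into one element of the power of \<open>A\<close>, whose principal congruence is described
  by the same equations coordinatewise, and so needs only finitely many boxes.\<close>

lemma EDPC_imp_box_iter_stable:
  assumes "has_EDPC (HSP A :: nat modal_algebra set)"
  shows "\<exists>n. \<forall>a\<in>carrier A. box_iter n a \<preceq> box_iter (Suc n) a"
proof (rule ccontr)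
  assume "\<not> ?thesis"
  then obtain a where a: "\<And>n. a n \<in> carrier A" "\<And>n. \<not> box_iter n (a n) \<preceq> box_iter (Suc n) (a n)"
    by metis
  define M where "M = power_algebra A (UNIV :: nat set)"
  interpret M: modal_algebra M unfolding M_def by (rule modal_algebra_power)
  have carrier_M: "f \<in> carrier M \<longleftrightarrow> (\<forall>i. f i \<in> carrier A)" for f
    by (auto simp: M_def PiE_iff)
  have ops_M: "mmeet M f g i = mmeet A (f i) (g i)" "mcompl M f i = mcompl A (f i)"
    "mdia M f i = mdia A (f i)" "mjoin M f g i = mjoin A (f i) (g i)" for f g i
    by (simp_all add: M_def)
  have iter_M: "M.box_iter k f i = box_iter k (f i)" for k f i
    by (induction k) (simp_all add: M.box_def box_def ops_M)
  define b where "b n = box_iter (Suc n) (a n)" for n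
  \<comment> \<open>The power has elements of type \<open>nat \<Rightarrow> 'a\<close>, so EDPC is
    first moved to that type.\<close>
  have "has_EDPC (HSP A :: (nat \<Rightarrow> 'a) modal_algebra set)"
    by (rule has_EDPC_any_type[OF closed assms])
  then obtain P where P: "defines_principal_congruences P M"
    using power_in_HSP[of "UNIV :: nat set"] unfolding has_EDPC_def M_def by blast
  define eqs where "eqs x y \<longleftrightarrow> (\<forall>(p, q)\<in>P.
    eval_term A (assign4 x (mtop A) y (mtop A)) p = eval_term A (assign4 x (mtop A) y (mtop A)) q)" for x y
  have eqs: "(g, mtop M) \<in> principal_congruence M f (mtop M) \<longleftrightarrow> (\<forall>i. eqs (f i) (g i))"
    if "f \<in> carrier M" "g \<in> carrier M" for f g
  proof -
    have asg: "(\<lambda>v. assign4 f (mtop M) g (mtop M) v i) = assign4 (f i) (mtop A) (g i) (mtop A)" for i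
      by (auto simp: assign4_def M_def split: var4.splits)
    have "eval_term M (assign4 f (mtop M) g (mtop M)) p i = eval_term A (assign4 (f i) (mtop A) (g i) (mtop A)) p" for p i
      unfolding asg[symmetric] M_def by (rule eval_term_power)
    then have "(\<forall>(p, q)\<in>P. eval_term M (assign4 f (mtop M) g (mtop M)) p = eval_term M (assign4 f (mtop M) g (mtop M)) q)
        \<longleftrightarrow> (\<forall>i. eqs (f i) (g i))"
      unfolding eqs_def fun_eq_iff by auto
    then show ?thesis
      using P that unfolding defines_principal_congruences_def by simp
  qed
  \<comment> \<open>The set \<open>P\<close> is known to define principal congruences in
    \<open>M\<close>, so the fact about a single \<open>a n\<close> in \<open>A\<close> is read off
    from the constant sequence with value \<open>a n\<close>.\<close>
  have ab_eqs: "eqs (a n) (b n)" for n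
  proof -
    let ?f = "\<lambda>_ :: nat. a n"
    have f: "?f \<in> carrier M" using a by (simp add: carrier_M)
    have "(M.box_iter (Suc n) ?f, mtop M) \<in> principal_congruence M ?f (mtop M)"
      unfolding principal_congruence_def by (blast intro: M.box_iter_congruent_top)
    then have "eqs (?f 0) (M.box_iter (Suc n) ?f 0)"
      using eqs[OF f, of "M.box_iter (Suc n) ?f"] M.box_iter_closed[OF f] by blast
    then show ?thesis by (simp only: iter_M b_def)
  qed
  have ab: "a \<in> carrier M" "b \<in> carrier M"
    using a by (simp_all add: carrier_M b_def del: box_iter.simps)
  then have "(b, mtop M) \<in> principal_congruence M a (mtop M)"
    by (simp add: eqs ab_eqs)
  \<comment> \<open>One \<open>k\<close> now serves all coordinates, and coordinate \<open>k\<close>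
    is where \<open>a\<close> was chosen to violate it.\<close>
  from M.principal_congruence_top_imp[OF ab(1) this]
  obtain k where "mjoin M (M.box_iter k a) b = b" ..
  then have "mjoin M (M.box_iter k a) b k = b k" by simp
  then have "box_iter k (a k) \<preceq> b k" by (simp only: ops_M iter_M)
  with a(2)[of k] show False by (simp only: b_def)
qed

section \<open>Open elements and congruences of finite index\<close>

lemma neg_box: "v \<in> carrier A \<Longrightarrow> \<sim> (box v) = mdia A (\<sim> v)"
  by (simp add: box_def neg_neg)

text \<open>For such \<open>u\<close>, \<open>meet_eq_dia\<close> applies with \<open>v = u\<close>,
  so agreement below \<open>u\<close> is compatible with all operations.\<close>

definition open_element :: "'a \<Rightarrow> bool" where
  "open_element u \<longleftrightarrow> u \<in> carrier A \<and> u \<preceq> box u"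

text \<open>Below \<open>u\<close> the complements of \<open>u \<curlywedge> v\<close> and of
  \<open>v\<close> agree. Openness of \<open>u\<close> carries this to their diamonds, and openness
  of \<open>v\<close> makes the second diamond vanish below
  \<open>u \<curlywedge> v\<close>.\<close>

lemma open_meet:
  assumes "open_element u" "open_element v"
  shows "open_element (u \<curlywedge> v)"
proof -
  have c: "u \<in> carrier A" "v \<in> carrier A" and o: "u \<preceq> box u" "v \<preceq> box v"
    using assms by (simp_all add: open_element_def)
  have "(u \<curlywedge> v) \<curlywedge> u = v \<curlywedge> u"
    using c by (metis meet_assoc meet_comm meet_idem)
  then have "\<sim> (u \<curlywedge> v) \<curlywedge> u = \<sim> v \<curlywedge> u"
    using c by (intro meet_eq_neg) simp_all
  moreover have "u \<curlywedge> v \<preceq> box u"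
    using c leq_trans[OF meet_lower(1) o(1)] by simp
  ultimately have "mdia A (\<sim> (u \<curlywedge> v)) \<curlywedge> (u \<curlywedge> v) = mdia A (\<sim> v) \<curlywedge> (u \<curlywedge> v)"
    using c by (intro meet_eq_dia) simp_all
  moreover have "u \<curlywedge> v \<preceq> \<sim> (mdia A (\<sim> v))"
    using c leq_trans[OF meet_lower(2) o(2)] by (simp add: box_def)
  ultimately have "(u \<curlywedge> v) \<curlywedge> mdia A (\<sim> (u \<curlywedge> v)) = mbot A"
    using c by (simp add: leq_neg_iff meet_comm)
  then have "u \<curlywedge> v \<preceq> box (u \<curlywedge> v)"
    using c by (simp add: box_def leq_neg_iff)
  then show ?thesis using c by (simp add: open_element_def)
qed

text \<open>The filter of top modulo the congruence contains the biconditional of the pair;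
  stability makes \<open>n\<close> nested boxes of it open.\<close>

lemma congruent_pair_unit:
  assumes stable: "\<And>a. a \<in> carrier A \<Longrightarrow> box_iter n a \<preceq> box_iter (Suc n) a"
    and \<theta>: "congruence A \<theta>" and xy: "(x, y) \<in> \<theta>"
  shows "\<exists>u. open_element u \<and> (u, mtop A) \<in> \<theta> \<and> x \<curlywedge> u = y \<curlywedge> u"
proof -
  have c: "x \<in> carrier A" "y \<in> carrier A" using congruenceD(1)[OF \<theta> xy] by auto
  \<comment> \<open>The biconditional of \<open>x\<close> and \<open>y\<close>: it is congruent to
    top because the pair is congruent, and by residuation \<open>x\<close> and \<open>y\<close>
    agree below it.\<close>
  define w where "w = (y \<curlyvee> \<sim> x) \<curlywedge> (x \<curlyvee> \<sim> y)"
  have w: "w \<in> carrier A" using c by (simp add: w_def)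
  have "(y \<curlyvee> \<sim> x, y \<curlyvee> \<sim> y) \<in> \<theta>" "(x \<curlyvee> \<sim> y, y \<curlyvee> \<sim> y) \<in> \<theta>"
    using \<theta> xy c by (auto intro!: congruenceD(5,7)[OF \<theta>] congruenceD(2)[OF \<theta>])
  then have w_top: "(w, mtop A) \<in> \<theta>"
    using congruenceD(8)[OF \<theta>] c unfolding w_def by (metis join_compl meet_idem op_closed(2))
  define u where "u = box_iter n w"
  have u: "u \<in> carrier A" using w by (simp add: u_def)
  have "u \<preceq> w" using box_iter_antimono[OF w, of 0 n] by (simp add: u_def)
  \<comment> \<open>By the recursion, \<open>box_iter (Suc n) w\<close> is
    \<open>w \<curlywedge> box u\<close>.\<close>
  have "u \<preceq> w \<curlywedge> box u" using stable[OF w] by (simp add: u_def)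
  then have "open_element u" using u w by (simp add: leq_meet_iff open_element_def)
  moreover have "(u, mtop A) \<in> \<theta>" unfolding u_def by (rule box_iter_congruent_top[OF \<theta> w_top])
  moreover have "x \<curlywedge> u = y \<curlywedge> u"
  proof (rule meet_eq_mono[OF meet_eqI \<open>u \<preceq> w\<close>])
    have "w \<curlywedge> x \<preceq> y" "w \<curlywedge> y \<preceq> x"
      using c w by (simp_all add: residuation) (simp_all add: w_def meet_lower)
    then show "x \<curlywedge> w \<preceq> y" "y \<curlywedge> w \<preceq> x" using c w by (simp_all add: meet_comm)
  qed (use c u w in simp_all)
  ultimately show ?thesis by blast
qed

text \<open>Finiteness of \<open>E\<close> is what allows taking the meet of the elements obtained
  for single pairs: it stays open and congruent to top, and agreement is inherited
  downwards.\<close>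

lemma finite_congruent_pairs_unit:
  assumes stable: "\<And>a. a \<in> carrier A \<Longrightarrow> box_iter n a \<preceq> box_iter (Suc n) a"
    and \<theta>: "congruence A \<theta>" and "finite E" "E \<subseteq> \<theta>"
  shows "\<exists>u. open_element u \<and> (u, mtop A) \<in> \<theta> \<and> (\<forall>(x, y)\<in>E. x \<curlywedge> u = y \<curlywedge> u)"
  using assms(3,4)
proof (induction E rule: finite_induct)
  case empty
  have "open_element (mtop A)" by (simp add: open_element_def box_top join_idem)
  then show ?case using congruenceD(2)[OF \<theta>] by auto
next
  case (insert e E)
  obtain u where u: "open_element u" "(u, mtop A) \<in> \<theta>" "\<forall>(x, y)\<in>E. x \<curlywedge> u = y \<curlywedge> u"
    using insert by auto
  obtain x y where e: "e = (x, y)" "(x, y) \<in> \<theta>" using insert.prems by (cases e) auto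
  obtain v where v: "open_element v" "(v, mtop A) \<in> \<theta>" "x \<curlywedge> v = y \<curlywedge> v"
    using congruent_pair_unit[OF stable \<theta> e(2)] by blast
  have c: "u \<in> carrier A" "v \<in> carrier A" using u(1) v(1) by (simp_all add: open_element_def)
  have "(u \<curlywedge> v, mtop A \<curlywedge> mtop A) \<in> \<theta>" by (rule congruenceD(8)[OF \<theta> u(2) v(2)])
  then have "(u \<curlywedge> v, mtop A) \<in> \<theta>" by (simp add: meet_idem)
  moreover have "x' \<curlywedge> (u \<curlywedge> v) = y' \<curlywedge> (u \<curlywedge> v)" if xy: "(x', y') \<in> insert e E" for x' y'
  proof -
    have c': "x' \<in> carrier A" "y' \<in> carrier A"
      using xy insert.prems congruenceD(1)[OF \<theta>] by auto
    have "x' \<curlywedge> u = y' \<curlywedge> u \<or> x' \<curlywedge> v = y' \<curlywedge> v" using xy u(3) v(3) e(1) by auto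
    then show ?thesis
      using meet_eq_mono[of x' u y' "u \<curlywedge> v"] meet_eq_mono[of x' v y' "u \<curlywedge> v"] c c'
      by (auto simp: meet_lower)
  qed
  ultimately show ?case using open_meet[OF u(1) v(1)] by blast
qed

text \<open>In a finitely generated algebra a congruence of finite index is determined by finitely many
  pairs: the operation tables on representatives, and the classes of the generators.\<close>

lemma finite_congruence_unit:
  assumes stable: "\<And>a. a \<in> carrier A \<Longrightarrow> box_iter n a \<preceq> box_iter (Suc n) a"
    and fg: "finitely_generated A" and \<theta>: "\<theta> \<in> finite_congruences A"
  shows "\<exists>u. open_element u \<and> finite {x \<in> carrier A. x \<preceq> u} \<and>
    (\<forall>x\<in>carrier A. \<forall>y\<in>carrier A. (x, y) \<in> \<theta> \<longleftrightarrow> x \<curlywedge> u = y \<curlywedge> u)"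
proof -
  obtain X where X: "finite X" "X \<subseteq> carrier A" "generated A X = carrier A"
    using fg by (auto simp: finitely_generated_def)
  have cong: "congruence A \<theta>" and fin: "finite (carrier A // \<theta>)"
    using \<theta> by (simp_all add: finite_congruences_def)
  have eq: "equiv (carrier A) \<theta>" using cong by (simp add: congruence_def)
  \<comment> \<open>The representative is chosen from the class, not from the element, so that
    congruent elements get equal representatives.\<close>
  define r where "r a = (SOME b. b \<in> \<theta> `` {a})" for a
  define R where "R = (\<lambda>c. SOME b. b \<in> c) ` (carrier A // \<theta>)"
  have rR: "r a \<in> R" if "a \<in> carrier A" for a
    using that unfolding r_def R_def by (intro imageI quotientI)
  have r: "(a, r a) \<in> \<theta>" if "a \<in> carrier A" for a
    using someI[of "\<lambda>b. b \<in> \<theta> `` {a}" a] congruenceD(2)[OF cong that] by (simp add: r_def)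
  have r_eq: "r a = r b" if "(a, b) \<in> \<theta>" for a b
    using equiv_class_eq[OF eq that] by (simp add: r_def)
  have R_sub: "R \<subseteq> carrier A"
  proof -
    have "\<exists>a\<in>carrier A. b = r a" if "b \<in> R" for b
      using that unfolding R_def r_def by (auto elim!: quotientE)
    then show ?thesis using r congruenceD(1)[OF cong] by blast
  qed
  have finR: "finite R" using fin by (simp add: R_def)
  define T where "T = X \<union> {mbot A, mtop A} \<union> mcompl A ` R \<union> mdia A ` R \<union>
    case_prod (mjoin A) ` (R \<times> R) \<union> case_prod (mmeet A) ` (R \<times> R)"
  have T: "finite T" "T \<subseteq> carrier A"
    using X finR R_sub by (auto simp: T_def)
  then have "(\<lambda>t. (t, r t)) ` T \<subseteq> \<theta>" using r by auto
  then obtain u where u: "open_element u" "(u, mtop A) \<in> \<theta>" "\<And>t. t \<in> T \<Longrightarrow> t \<curlywedge> u = r t \<curlywedge> u"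
    using finite_congruent_pairs_unit[OF stable cong finite_imageI[OF T(1)], of "\<lambda>t. (t, r t)"] by auto
  have uc: "u \<in> carrier A" and uo: "u \<preceq> box u" using u(1) by (simp_all add: open_element_def)
  have rc: "r a \<in> carrier A" if "a \<in> carrier A" for a using rR[OF that] R_sub by blast
  \<comment> \<open>The pairs indexed by \<open>T\<close> make \<open>u\<close> respect each
    operation on representatives, so these elements form a subuniverse; it contains the generators
    and is therefore everything.\<close>
  define G where "G = {a \<in> carrier A. a \<curlywedge> u = r a \<curlywedge> u}"
  have "subuniverse A G"
    unfolding subuniverse_def
  proof (intro conjI ballI)
    show "G \<subseteq> carrier A" by (auto simp: G_def)
    show "mbot A \<in> G" "mtop A \<in> G" using u(3) by (auto simp: G_def T_def)
    fix x assume "x \<in> G"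
    then have x: "x \<in> carrier A" "x \<curlywedge> u = r x \<curlywedge> u" by (auto simp: G_def)
    have "\<sim> x \<curlywedge> u = \<sim> (r x) \<curlywedge> u"
      using x uc rc by (intro meet_eq_neg) simp_all
    also have "\<dots> = r (\<sim> (r x)) \<curlywedge> u" using rR[OF x(1)] by (intro u(3)) (simp add: T_def)
    also have "r (\<sim> (r x)) = r (\<sim> x)"
      by (rule r_eq[symmetric]) (intro congruenceD(5)[OF cong] r x(1))
    finally show "\<sim> x \<in> G" using x by (simp add: G_def)
    have "mdia A x \<curlywedge> u = mdia A (r x) \<curlywedge> u"
      using x uc rc uo by (intro meet_eq_dia[of x u]) simp_all
    also have "\<dots> = r (mdia A (r x)) \<curlywedge> u" using rR[OF x(1)] by (intro u(3)) (simp add: T_def)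
    also have "r (mdia A (r x)) = r (mdia A x)"
      by (rule r_eq[symmetric]) (intro congruenceD(6)[OF cong] r x(1))
    finally show "mdia A x \<in> G" using x by (simp add: G_def)
    fix y assume "y \<in> G"
    then have y: "y \<in> carrier A" "y \<curlywedge> u = r y \<curlywedge> u" by (auto simp: G_def)
    have RR: "(r x, r y) \<in> R \<times> R" using rR x y by simp
    have "(x \<curlyvee> y) \<curlywedge> u = (r x \<curlyvee> r y) \<curlywedge> u"
      using x y uc rc by (intro meet_eq_join) simp_all
    also have "\<dots> = r (r x \<curlyvee> r y) \<curlywedge> u"
      using RR by (intro u(3)) (force simp: T_def)
    also have "r (r x \<curlyvee> r y) = r (x \<curlyvee> y)"
      by (rule r_eq[symmetric]) (intro congruenceD(7)[OF cong] r x(1) y(1))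
    finally show "x \<curlyvee> y \<in> G" using x y by (simp add: G_def)
    have "(x \<curlywedge> y) \<curlywedge> u = (r x \<curlywedge> r y) \<curlywedge> u"
      using x y uc rc by (intro meet_eq_meet) simp_all
    also have "\<dots> = r (r x \<curlywedge> r y) \<curlywedge> u"
      using RR by (intro u(3)) (force simp: T_def)
    also have "r (r x \<curlywedge> r y) = r (x \<curlywedge> y)"
      by (rule r_eq[symmetric]) (intro congruenceD(8)[OF cong] r x(1) y(1))
    finally show "x \<curlywedge> y \<in> G" using x y by (simp add: G_def)
  qed
  moreover have "X \<subseteq> G" using X(2) u(3) by (auto simp: G_def T_def)
  ultimately have "carrier A \<subseteq> G" using X(3) unfolding generated_def by blast
  then have G: "a \<curlywedge> u = r a \<curlywedge> u" if "a \<in> carrier A" for a using that by (auto simp: G_def)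
  \<comment> \<open>This is the converse direction: as \<open>u\<close> is congruent to top,
    agreement below \<open>u\<close> implies congruence.\<close>
  have "(x, x \<curlywedge> u) \<in> \<theta>" if "x \<in> carrier A" for x
    using congruenceD(8)[OF cong congruenceD(2)[OF cong that] congruenceD(3)[OF cong u(2)]] that
    by (simp add: meet_top)
  then have iff: "(x, y) \<in> \<theta> \<longleftrightarrow> x \<curlywedge> u = y \<curlywedge> u" if "x \<in> carrier A" "y \<in> carrier A" for x y
    using that G r_eq congruenceD(3,4)[OF cong] by metis
  \<comment> \<open>Distinct elements below \<open>u\<close> lie in distinct classes, so the finite
    index bounds the interval.\<close>
  have "inj_on (\<lambda>x. \<theta> `` {x}) {x \<in> carrier A. x \<preceq> u}"
  proof (rule inj_onI)
    fix x y assume xy: "x \<in> {x \<in> carrier A. x \<preceq> u}" "y \<in> {x \<in> carrier A. x \<preceq> u}"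
      and "\<theta> `` {x} = \<theta> `` {y}"
    then have "(x, y) \<in> \<theta>" using eq_equiv_class[OF _ eq] by blast
    then have "x \<curlywedge> u = y \<curlywedge> u" using iff xy by blast
    then show "x = y" using xy uc leq_iff_meet[of x u] leq_iff_meet[of y u] by simp
  qed
  moreover have "(\<lambda>x. \<theta> `` {x}) ` {x \<in> carrier A. x \<preceq> u} \<subseteq> carrier A // \<theta>"
    by (auto intro: quotientI)
  ultimately have "finite {x \<in> carrier A. x \<preceq> u}"
    using fin by (meson finite_imageD finite_subset)
  then show ?thesis using u(1) iff by blast
qed

end

text \<open>The supremum is picked by \<open>SOME\<close>, and antisymmetry makes the least upper
  bound unique. A partial order is enough, so this applies before any lattice structure is
  known.\<close>

lemma (in partial_order) sup_equality:
  assumes "S \<subseteq> carrier L" "s \<in> carrier L" "\<And>x. x \<in> S \<Longrightarrow> x \<sqsubseteq> s"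
    and "\<And>z. z \<in> carrier L \<Longrightarrow> (\<And>x. x \<in> S \<Longrightarrow> x \<sqsubseteq> z) \<Longrightarrow> s \<sqsubseteq> z"
  shows "\<Squnion>S = s"
proof -
  have l: "least L s (Upper L S)"
    using assms(1) by (intro least_UpperI assms) (auto simp: Upper_def)
  show ?thesis unfolding sup_def by (rule some_equality, rule l, erule least_unique, rule l)
qed

lemma (in partial_order) inf_equality:
  assumes "S \<subseteq> carrier L" "s \<in> carrier L" "\<And>x. x \<in> S \<Longrightarrow> s \<sqsubseteq> x"
    and "\<And>z. z \<in> carrier L \<Longrightarrow> (\<And>x. x \<in> S \<Longrightarrow> z \<sqsubseteq> x) \<Longrightarrow> z \<sqsubseteq> s"
  shows "\<Sqinter>S = s"
proof -
  have g: "greatest L s (Lower L S)"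
    using assms(1) by (intro greatest_LowerI assms) (auto simp: Lower_def)
  show ?thesis unfolding inf_def by (rule some_equality, rule g, erule greatest_unique, rule g)
qed

lemma lattice_of_simps [simp]:
  "carrier (lattice_of B) = carrier B" "(x \<sqsubseteq>\<^bsub>lattice_of B\<^esub> y) \<longleftrightarrow> mjoin B x y = y"
  "(x .=\<^bsub>lattice_of B\<^esub> y) \<longleftrightarrow> x = y"
  by (simp_all add: lattice_of_def)

lemma (in modal_algebra) partial_order_lattice_of: "partial_order (lattice_of A)"
proof
  show "(.=\<^bsub>lattice_of A\<^esub>) = (=)" by (simp add: lattice_of_def)
  show "x .=\<^bsub>lattice_of A\<^esub> y" if "x \<sqsubseteq>\<^bsub>lattice_of A\<^esub> y" "y \<sqsubseteq>\<^bsub>lattice_of A\<^esub> x"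
    "x \<in> carrier (lattice_of A)" "y \<in> carrier (lattice_of A)" for x y
    using that leq_antisym[of x y] by simp
  show "x \<sqsubseteq>\<^bsub>lattice_of A\<^esub> z" if "x \<sqsubseteq>\<^bsub>lattice_of A\<^esub> y" "y \<sqsubseteq>\<^bsub>lattice_of A\<^esub> z"
    "x \<in> carrier (lattice_of A)" "y \<in> carrier (lattice_of A)" "z \<in> carrier (lattice_of A)" for x y z
    using that leq_trans[of x y z] by simp
qed (simp_all add: join_idem)

text \<open>\<open>lattice_completion\<close> refers to joins and meets derived from the order, so
  these have to be identified with the operations of the algebra.\<close>

lemma (in modal_algebra) lattice_of_ops:
  assumes "x \<in> carrier A" "y \<in> carrier A"
  shows "x \<squnion>\<^bsub>lattice_of A\<^esub> y = x \<curlyvee> y" "x \<sqinter>\<^bsub>lattice_of A\<^esub> y = x \<curlywedge> y"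
proof -
  interpret L: partial_order "lattice_of A" by (rule partial_order_lattice_of)
  show "x \<squnion>\<^bsub>lattice_of A\<^esub> y = x \<curlyvee> y"
    unfolding join_def using assms by (intro L.sup_equality) (auto simp: join_upper join_leq_iff)
  show "x \<sqinter>\<^bsub>lattice_of A\<^esub> y = x \<curlywedge> y"
    unfolding meet_def using assms by (intro L.inf_equality) (auto simp: meet_lower leq_meet_iff)
qed

section \<open>Finite congruences given by open elements\<close>

text \<open>Each quotient of finite index is the relativization of the algebra to the finite interval
  below \<open>unit \<theta>\<close>.\<close>

locale unital_modal_algebra = modal_algebra A for A :: "'a modal_algebra" +
  fixes unit :: "('a \<times> 'a) set \<Rightarrow> 'a"
  assumes unit_open: "\<theta> \<in> finite_congruences A \<Longrightarrow> open_element (unit \<theta>)"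
    and unit_finite: "\<theta> \<in> finite_congruences A \<Longrightarrow> finite {x \<in> carrier A. x \<preceq> unit \<theta>}"
    and unit_iff: "\<lbrakk>\<theta> \<in> finite_congruences A; x \<in> carrier A; y \<in> carrier A\<rbrakk> \<Longrightarrow>
      (x, y) \<in> \<theta> \<longleftrightarrow> x \<curlywedge> unit \<theta> = y \<curlywedge> unit \<theta>"
    and residual: "residually_finite A"
begin

abbreviation \<Phi> where "\<Phi> \<equiv> finite_congruences A"

lemma unit_closed [simp, intro]: "\<theta> \<in> \<Phi> \<Longrightarrow> unit \<theta> \<in> carrier A"
  using unit_open by (simp add: open_element_def)

lemma \<Phi>_equiv: "\<theta> \<in> \<Phi> \<Longrightarrow> equiv (carrier A) \<theta>"
  by (simp add: finite_congruences_def congruence_def)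

lemma class_eq_iff:
  assumes "\<theta> \<in> \<Phi>" "x \<in> carrier A" "y \<in> carrier A"
  shows "\<theta> `` {x} = \<theta> `` {y} \<longleftrightarrow> x \<curlywedge> unit \<theta> = y \<curlywedge> unit \<theta>"
  using eq_equiv_class_iff[OF \<Phi>_equiv[OF assms(1)] assms(2,3)] unit_iff[OF assms] by simp

text \<open>If \<open>c\<close> is not below \<open>d\<close>, then \<open>c \<curlyvee> d\<close>
  and \<open>d\<close> differ and some congruence of finite index separates them. But they agree
  below its unit.\<close>

lemma leq_by_units:
  assumes c: "c \<in> carrier A" "d \<in> carrier A" and "\<And>\<theta>. \<theta> \<in> \<Phi> \<Longrightarrow> c \<curlywedge> unit \<theta> \<preceq> d"
  shows "c \<preceq> d"
proof (rule ccontr)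
  assume "\<not> c \<preceq> d"
  then obtain \<theta> where \<theta>: "\<theta> \<in> \<Phi>" "\<theta> `` {c \<curlyvee> d} \<noteq> \<theta> `` {d}"
    using residual c unfolding residually_finite_def by (metis op_closed(5))
  have "c \<curlywedge> unit \<theta> \<preceq> d \<curlywedge> unit \<theta>"
    using assms \<theta> by (simp add: leq_meet_iff meet_lower)
  then have "(c \<curlyvee> d) \<curlywedge> unit \<theta> = d \<curlywedge> unit \<theta>"
    using c \<theta> by (simp add: join_meet_distrib_right)
  with \<theta> c show False by (simp add: class_eq_iff)
qed

text \<open>The members of the ideal below \<open>unit \<theta>\<close> form a finite set closed
  under joins, so it has a maximum; downward closure puts every
  \<open>b \<curlywedge> unit \<theta>\<close> into that set.\<close>

lemma ideal_max_below_unit: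
  assumes "I \<subseteq> carrier A" "mbot A \<in> I" "\<And>x y. x \<in> I \<Longrightarrow> y \<in> I \<Longrightarrow> x \<curlyvee> y \<in> I"
    and down: "\<And>x y. x \<in> I \<Longrightarrow> y \<in> carrier A \<Longrightarrow> y \<preceq> x \<Longrightarrow> y \<in> I" and \<theta>: "\<theta> \<in> \<Phi>"
  shows "\<exists>a\<in>I. a \<preceq> unit \<theta> \<and> (\<forall>b\<in>I. b \<curlywedge> unit \<theta> \<preceq> a)"
proof -
  let ?F = "{x \<in> I. x \<preceq> unit \<theta>}"
  have "\<exists>m\<in>?F. \<forall>x\<in>?F. x \<preceq> m"
  proof (rule finite_directed_has_max)
    show "finite ?F" using assms(1) by (intro finite_subset[OF _ unit_finite[OF \<theta>]]) auto
    show "?F \<noteq> {}" using assms(2) \<theta> bot_leq by blast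
    show "?F \<subseteq> carrier A" using assms(1) by auto
    show "x \<curlyvee> y \<in> ?F" if "x \<in> ?F" "y \<in> ?F" for x y
    proof -
      have "x \<in> carrier A" "y \<in> carrier A" using that assms(1) by auto
      then show ?thesis using that assms(3) \<theta> by (simp add: join_leq_iff)
    qed
  qed
  then obtain a where a: "a \<in> I" "a \<preceq> unit \<theta>" "\<And>x. x \<in> I \<Longrightarrow> x \<preceq> unit \<theta> \<Longrightarrow> x \<preceq> a" by blast
  have "b \<curlywedge> unit \<theta> \<preceq> a" if "b \<in> I" for b
  proof -
    have "b \<in> carrier A" using that assms(1) by auto
    then have "b \<curlywedge> unit \<theta> \<in> I" using \<theta> that by (intro down[OF that]) (simp_all add: meet_lower)
    then show ?thesis using \<open>b \<in> carrier A\<close> \<theta> by (intro a(3)) (simp_all add: meet_lower)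
  qed
  then show ?thesis using a by blast
qed

section \<open>Smoothness\<close>

text \<open>At each \<open>\<theta>\<close> some \<open>a\<close> satisfies \<open>m a\<close> below
  \<open>x\<close> and \<open>x\<close> below
  \<open>m (a \<curlyvee> \<sim> (unit \<theta>))\<close>. The diamonds of these two bounds agree
  below \<open>unit \<theta>\<close> by openness, and units suffice to test inequalities in
  \<open>A\<close>.\<close>

lemma smooth_dia:
  fixes m :: "'a \<Rightarrow> 'c" and C :: "'c gorder"
  assumes mac: "macneille_completion (lattice_of A) m C"
  shows "smooth (lattice_of A) m C (mdia A)"
proof -
  have "complete_lattice C"
    using mac by (simp add: macneille_completion_def lattice_completion_def)
  then interpret C: complete_lattice C .
  have m_in [simp]: "m a \<in> carrier C" if "a \<in> carrier A" for a
    using mac that by (auto simp: macneille_completion_def lattice_completion_def)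
  have m_join: "m (a \<curlyvee> b) = m a \<squnion>\<^bsub>C\<^esub> m b" if "a \<in> carrier A" "b \<in> carrier A" for a b
    using mac that by (simp add: macneille_completion_def lattice_completion_def lattice_of_ops)
  have inj: "inj_on m (carrier A)"
    using mac by (simp add: macneille_completion_def lattice_completion_def)
  \<comment> \<open>Preservation of joins gives one direction, injectivity the other.\<close>
  have m_leq: "m a \<sqsubseteq>\<^bsub>C\<^esub> m b \<longleftrightarrow> a \<preceq> b" if ab: "a \<in> carrier A" "b \<in> carrier A" for a b
  proof
    assume "m a \<sqsubseteq>\<^bsub>C\<^esub> m b"
    then have "m a \<squnion>\<^bsub>C\<^esub> m b = m b"
      using ab by (intro C.le_antisym C.join_le C.join_right) simp_all
    then show "a \<preceq> b" using inj ab m_join by (metis inj_onD op_closed(5))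
  next
    assume "a \<preceq> b"
    then have "m b = m a \<squnion>\<^bsub>C\<^esub> m b" using ab m_join by metis
    then show "m a \<sqsubseteq>\<^bsub>C\<^esub> m b" using ab C.join_left[of "m a" "m b"] by simp
  qed
  \<comment> \<open>Join-density means that inequalities are tested on elements of \<open>A\<close>
    from below; \<open>above\<close> is the same for meet-density.\<close>
  have below: "x \<sqsubseteq>\<^bsub>C\<^esub> z" if xz: "x \<in> carrier C" "z \<in> carrier C"
    and le: "\<And>a. a \<in> carrier A \<Longrightarrow> m a \<sqsubseteq>\<^bsub>C\<^esub> x \<Longrightarrow> m a \<sqsubseteq>\<^bsub>C\<^esub> z" for x z
  proof -
    obtain S where S: "S \<subseteq> m ` carrier A" "x = \<Squnion>\<^bsub>C\<^esub> S"
      using mac xz by (auto simp: macneille_completion_def join_dense_def)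
    then have sub: "S \<subseteq> carrier C" by auto
    show ?thesis
      unfolding S(2)
    proof (rule C.sup_least[OF sub xz(2)])
      fix y assume y: "y \<in> S"
      moreover have "y \<sqsubseteq>\<^bsub>C\<^esub> x" unfolding S(2) by (rule C.sup_upper[OF sub y])
      ultimately show "y \<sqsubseteq>\<^bsub>C\<^esub> z" using S(1) le by blast
    qed
  qed
  have above: "z \<sqsubseteq>\<^bsub>C\<^esub> x" if xz: "x \<in> carrier C" "z \<in> carrier C"
    and le: "\<And>a. a \<in> carrier A \<Longrightarrow> x \<sqsubseteq>\<^bsub>C\<^esub> m a \<Longrightarrow> z \<sqsubseteq>\<^bsub>C\<^esub> m a" for x z
  proof -
    obtain S where S: "S \<subseteq> m ` carrier A" "x = \<Sqinter>\<^bsub>C\<^esub> S"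
      using mac xz by (auto simp: macneille_completion_def meet_dense_def)
    then have sub: "S \<subseteq> carrier C" by auto
    show ?thesis
      unfolding S(2)
    proof (rule C.inf_greatest[OF sub xz(2)])
      fix y assume y: "y \<in> S"
      moreover have "x \<sqsubseteq>\<^bsub>C\<^esub> y" unfolding S(2) by (rule C.inf_lower[OF sub y])
      ultimately show "z \<sqsubseteq>\<^bsub>C\<^esub> y" using S(1) le by blast
    qed
  qed
  have "lower_extension (lattice_of A) m C (mdia A) x = upper_extension (lattice_of A) m C (mdia A) x"
    if x: "x \<in> carrier C" for x
  proof -
    let ?l = "lower_extension (lattice_of A) m C (mdia A) x"
    let ?u = "upper_extension (lattice_of A) m C (mdia A) x"
    let ?S = "{m (mdia A a) | a. a \<in> carrier A \<and> m a \<sqsubseteq>\<^bsub>C\<^esub> x}"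
    let ?T = "{m (mdia A a) | a. a \<in> carrier A \<and> x \<sqsubseteq>\<^bsub>C\<^esub> m a}"
    have l: "?l = \<Squnion>\<^bsub>C\<^esub> ?S" and u: "?u = \<Sqinter>\<^bsub>C\<^esub> ?T"
      by (simp_all add: lower_extension_def upper_extension_def)
    have ST: "?S \<subseteq> carrier C" "?T \<subseteq> carrier C" by auto
    have lu: "?l \<in> carrier C" "?u \<in> carrier C"
      unfolding l u using ST by simp_all
    have l_upper: "m (mdia A a) \<sqsubseteq>\<^bsub>C\<^esub> ?l" if "a \<in> carrier A" "m a \<sqsubseteq>\<^bsub>C\<^esub> x" for a
      unfolding l by (rule C.sup_upper[OF ST(1)]) (use that in blast)
    have u_lower: "?u \<sqsubseteq>\<^bsub>C\<^esub> m (mdia A a)" if "a \<in> carrier A" "x \<sqsubseteq>\<^bsub>C\<^esub> m a" for a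
      unfolding u by (rule C.inf_lower[OF ST(2)]) (use that in blast)
    have "?l \<sqsubseteq>\<^bsub>C\<^esub> ?u"
      unfolding l
    proof (rule C.sup_least[OF ST(1) lu(2)])
      fix y assume "y \<in> ?S"
      then obtain a where a: "a \<in> carrier A" "m a \<sqsubseteq>\<^bsub>C\<^esub> x" "y = m (mdia A a)" by blast
      show "y \<sqsubseteq>\<^bsub>C\<^esub> ?u"
        unfolding u
      proof (rule C.inf_greatest[OF ST(2)])
        fix z assume "z \<in> ?T"
        then obtain b where b: "b \<in> carrier A" "x \<sqsubseteq>\<^bsub>C\<^esub> m b" "z = m (mdia A b)" by blast
        have "m a \<sqsubseteq>\<^bsub>C\<^esub> m b" using C.le_trans[OF a(2) b(2)] a b x by simp
        then show "y \<sqsubseteq>\<^bsub>C\<^esub> z" using a b by (simp add: m_leq dia_mono)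
      qed (use a in simp)
    qed
    moreover have "?u \<sqsubseteq>\<^bsub>C\<^esub> ?l"
    proof (rule below[OF lu(2,1)], rule above[OF lu(1)])
      \<comment> \<open>By the two densities it is enough to compare an element of \<open>A\<close>
        below the upper extension with one above the lower extension.\<close>
      fix c d assume c: "c \<in> carrier A" "m c \<sqsubseteq>\<^bsub>C\<^esub> ?u" and d: "d \<in> carrier A" "?l \<sqsubseteq>\<^bsub>C\<^esub> m d"
      have "c \<preceq> d"
      proof (rule leq_by_units)
        fix \<theta> assume \<theta>: "\<theta> \<in> \<Phi>"
        define I where "I = {a \<in> carrier A. m a \<sqsubseteq>\<^bsub>C\<^esub> x}"
        have "\<exists>a\<in>I. a \<preceq> unit \<theta> \<and> (\<forall>b\<in>I. b \<curlywedge> unit \<theta> \<preceq> a)"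
        proof (rule ideal_max_below_unit[OF _ _ _ _ \<theta>])
          \<comment> \<open>Completions preserve only binary joins and meets, so that
            \<open>m (mbot A)\<close> is below everything comes from meet-density.\<close>
          have "m (mbot A) \<sqsubseteq>\<^bsub>C\<^esub> x"
            by (rule above[OF x]) (simp_all add: m_leq bot_leq)
          then show "mbot A \<in> I" by (simp add: I_def)
          show "a \<curlyvee> b \<in> I" if "a \<in> I" "b \<in> I" for a b
            using that x by (auto simp: I_def m_join intro!: C.join_le)
          show "b \<in> I" if "a \<in> I" "b \<in> carrier A" "b \<preceq> a" for a b
            using that x C.le_trans[of "m b" "m a" x] by (auto simp: I_def m_leq)
        qed (auto simp: I_def)
        then obtain a where a: "a \<in> carrier A" "m a \<sqsubseteq>\<^bsub>C\<^esub> x"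
          and max: "\<And>b. b \<in> I \<Longrightarrow> b \<curlywedge> unit \<theta> \<preceq> a" by (auto simp: I_def)
        let ?b = "a \<curlyvee> \<sim> (unit \<theta>)"
        \<comment> \<open>Any \<open>b\<close> with \<open>m b\<close> below \<open>x\<close> lies
          in \<open>I\<close>, so \<open>b \<curlywedge> unit \<theta>\<close> is below
          \<open>a\<close>; residuation and join-density conclude.\<close>
        have "x \<sqsubseteq>\<^bsub>C\<^esub> m ?b"
          using max a \<theta> by (intro below[OF x]) (simp_all add: m_leq residuation I_def)
        then have "?u \<sqsubseteq>\<^bsub>C\<^esub> m (mdia A ?b)" using a \<theta> by (intro u_lower) auto
        then have "m c \<sqsubseteq>\<^bsub>C\<^esub> m (mdia A ?b)"
          using C.le_trans[OF c(2)] c a \<theta> lu by simp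
        then have "c \<preceq> mdia A a \<curlyvee> \<sim> (box (unit \<theta>))"
          using c a \<theta> by (simp add: m_leq dia_join neg_box)
        then have "c \<curlywedge> box (unit \<theta>) \<preceq> mdia A a"
          using c a \<theta> by (simp add: residuation)
        moreover have "c \<curlywedge> unit \<theta> \<preceq> c \<curlywedge> box (unit \<theta>)"
          using c \<theta> unit_open[OF \<theta>] by (intro meet_mono) (simp_all add: join_idem open_element_def)
        moreover have "mdia A a \<preceq> d"
          using C.le_trans[OF l_upper[OF a] d(2)] a d lu by (simp add: m_leq)
        ultimately show "c \<curlywedge> unit \<theta> \<preceq> d"
          using c a d \<theta> leq_trans[of "c \<curlywedge> unit \<theta>" "c \<curlywedge> box (unit \<theta>)" "mdia A a"]
            leq_trans[of "c \<curlywedge> unit \<theta>" "mdia A a" d] by simp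
      qed (use c d in simp_all)
      then show "m c \<sqsubseteq>\<^bsub>C\<^esub> m d" using c d by (simp add: m_leq)
    qed simp
    ultimately show ?thesis using lu by (intro C.le_antisym)
  qed
  then show ?thesis by (simp add: smooth_def)
qed

section \<open>The profinite completion\<close>

abbreviation P where "P \<equiv> profinite_completion A"
abbreviation \<mu> where "\<mu> \<equiv> profinite_map A"

lemma carrier_P:
  "\<alpha> \<in> carrier P \<longleftrightarrow> \<alpha> \<in> (\<Pi>\<^sub>E \<theta>\<in>\<Phi>. carrier A // \<theta>) \<and>
    (\<forall>\<theta>\<in>\<Phi>. \<forall>\<psi>\<in>\<Phi>. \<theta> \<subseteq> \<psi> \<longrightarrow> (\<forall>a\<in>carrier A. \<alpha> \<theta> = \<theta> `` {a} \<longrightarrow> \<alpha> \<psi> = \<psi> `` {a}))"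
  by (simp add: profinite_completion_def quotient_algebra_def Let_def)

text \<open>Congruence makes all classes in the defining union equal, and the union is taken over a
  nonempty family.\<close>

lemma quotient_join:
  assumes \<theta>: "\<theta> \<in> \<Phi>" and xy: "x \<in> carrier A" "y \<in> carrier A"
  shows "mjoin (quotient_algebra A \<theta>) (\<theta> `` {x}) (\<theta> `` {y}) = \<theta> `` {x \<curlyvee> y}"
proof -
  have cong: "congruence A \<theta>" using \<theta> by (simp add: finite_congruences_def)
  have "\<theta> `` {x' \<curlyvee> y'} = \<theta> `` {x \<curlyvee> y}" if "x' \<in> \<theta> `` {x}" "y' \<in> \<theta> `` {y}" for x' y'
    using equiv_class_eq[OF \<Phi>_equiv[OF \<theta>] congruenceD(7)[OF cong, of x x' y y']] that by simp
  moreover have "x \<in> \<theta> `` {x}" "y \<in> \<theta> `` {y}" using congruenceD(2)[OF cong] xy by auto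
  ultimately have "(\<Union>x'\<in>\<theta> `` {x}. \<Union>y'\<in>\<theta> `` {y}. \<theta> `` {x' \<curlyvee> y'}) = \<theta> `` {x \<curlyvee> y}"
    by blast
  then show ?thesis by (simp add: quotient_algebra_def)
qed

text \<open>Each class modulo \<open>\<theta>\<close> has exactly one element below
  \<open>unit \<theta>\<close>, so the choice is canonical. Members of the completion thereby become
  families of elements of \<open>A\<close>, and coherence becomes restriction to a smaller
  unit.\<close>

definition proj :: "(('a \<times> 'a) set \<Rightarrow> 'a set) \<Rightarrow> ('a \<times> 'a) set \<Rightarrow> 'a" where
  "proj \<alpha> \<theta> = (SOME a. a \<in> carrier A \<and> a \<preceq> unit \<theta> \<and> \<alpha> \<theta> = \<theta> `` {a})"

lemma proj:
  assumes "\<alpha> \<in> carrier P" "\<theta> \<in> \<Phi>"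
  shows "proj \<alpha> \<theta> \<in> carrier A" "proj \<alpha> \<theta> \<preceq> unit \<theta>" "\<alpha> \<theta> = \<theta> `` {proj \<alpha> \<theta>}"
proof -
  have "\<alpha> \<theta> \<in> carrier A // \<theta>" using assms by (auto simp: carrier_P PiE_iff)
  then obtain a where a: "a \<in> carrier A" "\<alpha> \<theta> = \<theta> `` {a}" by (auto elim: quotientE)
  have "a \<curlywedge> unit \<theta> = (a \<curlywedge> unit \<theta>) \<curlywedge> unit \<theta>"
    using a assms by (simp add: meet_assoc meet_idem)
  then have "\<alpha> \<theta> = \<theta> `` {a \<curlywedge> unit \<theta>}"
    using a assms class_eq_iff[of \<theta> a "a \<curlywedge> unit \<theta>"] by simp
  then have "\<exists>a. a \<in> carrier A \<and> a \<preceq> unit \<theta> \<and> \<alpha> \<theta> = \<theta> `` {a}"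
    using a assms by (intro exI[of _ "a \<curlywedge> unit \<theta>"]) (simp add: meet_lower)
  from someI_ex[OF this] show "proj \<alpha> \<theta> \<in> carrier A" "proj \<alpha> \<theta> \<preceq> unit \<theta>" "\<alpha> \<theta> = \<theta> `` {proj \<alpha> \<theta>}"
    unfolding proj_def by blast+
qed

lemma leq_unit_meet:
  "x \<in> carrier A \<Longrightarrow> \<theta> \<in> \<Phi> \<Longrightarrow> x \<preceq> unit \<theta> \<Longrightarrow> x \<curlywedge> unit \<theta> = x"
  by (simp only: leq_iff_meet unit_closed)

lemma proj_equality:
  assumes "\<alpha> \<in> carrier P" "\<theta> \<in> \<Phi>" "a \<in> carrier A" "\<alpha> \<theta> = \<theta> `` {a}"
  shows "proj \<alpha> \<theta> = a \<curlywedge> unit \<theta>"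
  using proj[OF assms(1,2)] class_eq_iff[OF assms(2) _ assms(3)] assms leq_unit_meet by metis

lemma proj_coherent:
  assumes "\<alpha> \<in> carrier P" "\<theta> \<in> \<Phi>" "\<psi> \<in> \<Phi>" "\<theta> \<subseteq> \<psi>"
  shows "proj \<alpha> \<psi> = proj \<alpha> \<theta> \<curlywedge> unit \<psi>"
proof (rule proj_equality)
  show "\<alpha> \<psi> = \<psi> `` {proj \<alpha> \<theta>}"
    using assms proj[OF assms(1,2)] unfolding carrier_P by blast
qed (use assms in \<open>simp_all add: proj\<close>)

text \<open>Classes of the intersection are intersections of classes, hence finitely many. The
  intersection is a common refinement through which any two coordinates can be compared.\<close>

lemma \<Phi>_Int:
  assumes "\<theta> \<in> \<Phi>" "\<psi> \<in> \<Phi>"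
  shows "\<theta> \<inter> \<psi> \<in> \<Phi>"
proof -
  have "congruence A (\<Inter>{\<theta>, \<psi>})"
    using assms by (intro congruence_Inter) (auto simp: finite_congruences_def)
  moreover have "carrier A // (\<theta> \<inter> \<psi>) \<subseteq> (\<lambda>(U, V). U \<inter> V) ` ((carrier A // \<theta>) \<times> (carrier A // \<psi>))"
  proof
    fix U assume "U \<in> carrier A // (\<theta> \<inter> \<psi>)"
    then obtain a where "a \<in> carrier A" "U = (\<theta> \<inter> \<psi>) `` {a}" by (auto elim: quotientE)
    then have "U = \<theta> `` {a} \<inter> \<psi> `` {a}" "(\<theta> `` {a}, \<psi> `` {a}) \<in> (carrier A // \<theta>) \<times> (carrier A // \<psi>)"
      by (auto intro: quotientI)
    then show "U \<in> (\<lambda>(U, V). U \<inter> V) ` ((carrier A // \<theta>) \<times> (carrier A // \<psi>))" by auto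
  qed
  then have "finite (carrier A // (\<theta> \<inter> \<psi>))"
    by (rule finite_subset) (use assms in \<open>simp add: finite_congruences_def\<close>)
  ultimately show ?thesis by (simp add: finite_congruences_def)
qed

text \<open>Both projections are restrictions of the one at \<open>\<theta> \<inter> \<psi>\<close>,
  so the two sides are the same element restricted to both units.\<close>

lemma proj_cross:
  assumes "\<alpha> \<in> carrier P" "\<theta> \<in> \<Phi>" "\<psi> \<in> \<Phi>"
  shows "proj \<alpha> \<theta> \<curlywedge> unit \<psi> = proj \<alpha> \<psi> \<curlywedge> unit \<theta>"
proof -
  have \<chi>: "\<theta> \<inter> \<psi> \<in> \<Phi>" using assms by (simp add: \<Phi>_Int)
  let ?p = "proj \<alpha> (\<theta> \<inter> \<psi>)"
  have "proj \<alpha> \<theta> = ?p \<curlywedge> unit \<theta>" "proj \<alpha> \<psi> = ?p \<curlywedge> unit \<psi>"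
    using proj_coherent[OF assms(1) \<chi>] assms by auto
  then show ?thesis
    using proj(1)[OF assms(1) \<chi>] assms by (simp add: meet_assoc meet_comm[of "unit \<theta>" "unit \<psi>"])
qed

lemma proj_ext:
  assumes "\<alpha> \<in> carrier P" "\<beta> \<in> carrier P" "\<And>\<theta>. \<theta> \<in> \<Phi> \<Longrightarrow> proj \<alpha> \<theta> = proj \<beta> \<theta>"
  shows "\<alpha> = \<beta>"
proof (rule PiE_ext)
  show "\<alpha> \<in> (\<Pi>\<^sub>E \<theta>\<in>\<Phi>. carrier A // \<theta>)" "\<beta> \<in> (\<Pi>\<^sub>E \<theta>\<in>\<Phi>. carrier A // \<theta>)"
    using assms(1,2) by (simp_all add: carrier_P)
  show "\<alpha> \<theta> = \<beta> \<theta>" if "\<theta> \<in> \<Phi>" for \<theta>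
    using proj(3)[OF assms(1) that] proj(3)[OF assms(2) that] assms(3)[OF that] by simp
qed

text \<open>\<open>unit \<theta>\<close> is congruent to top modulo \<open>\<theta>\<close>, hence
  modulo \<open>\<psi>\<close>, and so it lies above \<open>unit \<psi>\<close>: larger congruences
  have smaller units.\<close>

lemma unit_mono:
  assumes "\<theta> \<in> \<Phi>" "\<psi> \<in> \<Phi>" "\<theta> \<subseteq> \<psi>"
  shows "unit \<psi> \<preceq> unit \<theta>"
proof -
  have "unit \<theta> \<curlywedge> unit \<theta> = mtop A \<curlywedge> unit \<theta>"
    using assms(1) meet_comm[of "mtop A" "unit \<theta>"] by (simp add: meet_top meet_idem)
  then have "(unit \<theta>, mtop A) \<in> \<theta>" using unit_iff assms(1) by simp
  then have "unit \<theta> \<curlywedge> unit \<psi> = mtop A \<curlywedge> unit \<psi>" using unit_iff[of \<psi>] assms by auto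
  then show ?thesis
    using assms meet_comm[of "mtop A" "unit \<psi>"] meet_comm[of "unit \<theta>" "unit \<psi>"]
    by (simp add: meet_top leq_iff_meet)
qed

text \<open>The way back from families of elements to members of the completion, needed to construct
  infima.\<close>

lemma thread:
  assumes f: "\<And>\<theta>. \<theta> \<in> \<Phi> \<Longrightarrow> f \<theta> \<in> carrier A" "\<And>\<theta>. \<theta> \<in> \<Phi> \<Longrightarrow> f \<theta> \<preceq> unit \<theta>"
    and coh: "\<And>\<theta> \<psi>. \<theta> \<in> \<Phi> \<Longrightarrow> \<psi> \<in> \<Phi> \<Longrightarrow> \<theta> \<subseteq> \<psi> \<Longrightarrow> f \<psi> = f \<theta> \<curlywedge> unit \<psi>"
  shows "(\<lambda>\<theta>\<in>\<Phi>. \<theta> `` {f \<theta>}) \<in> carrier P"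
    and "\<theta> \<in> \<Phi> \<Longrightarrow> proj (\<lambda>\<theta>\<in>\<Phi>. \<theta> `` {f \<theta>}) \<theta> = f \<theta>"
proof -
  \<comment> \<open>Coherence in the completion is demanded for every representative
    \<open>a\<close> of the class, not just for \<open>f \<theta>\<close>.\<close>
  have key: "\<psi> `` {f \<psi>} = \<psi> `` {a}"
    if h: "\<theta> \<in> \<Phi>" "\<psi> \<in> \<Phi>" "\<theta> \<subseteq> \<psi>" "a \<in> carrier A" "\<theta> `` {f \<theta>} = \<theta> `` {a}" for \<theta> \<psi> a
  proof -
    have "f \<theta> = a \<curlywedge> unit \<theta>"
      using h f class_eq_iff[of \<theta> "f \<theta>" a] leq_unit_meet[of "f \<theta>" \<theta>] by simp
    moreover have "unit \<theta> \<curlywedge> unit \<psi> = unit \<psi>"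
      using unit_mono[OF h(1-3)] h meet_comm[of "unit \<theta>" "unit \<psi>"] leq_iff_meet[of "unit \<psi>" "unit \<theta>"] by simp
    ultimately have "f \<psi> = a \<curlywedge> unit \<psi>" using coh[OF h(1-3)] h by (simp add: meet_assoc)
    then show ?thesis using h f by (simp add: class_eq_iff meet_assoc meet_idem)
  qed
  show *: "(\<lambda>\<theta>\<in>\<Phi>. \<theta> `` {f \<theta>}) \<in> carrier P"
    unfolding carrier_P
  proof (intro conjI ballI impI)
    show "(\<lambda>\<theta>\<in>\<Phi>. \<theta> `` {f \<theta>}) \<in> (\<Pi>\<^sub>E \<theta>\<in>\<Phi>. carrier A // \<theta>)" using f(1) by (simp add: quotientI)
  next
    fix \<theta> \<psi> a
    assume h: "\<theta> \<in> \<Phi>" "\<psi> \<in> \<Phi>" "\<theta> \<subseteq> \<psi>" "a \<in> carrier A" "(\<lambda>\<theta>\<in>\<Phi>. \<theta> `` {f \<theta>}) \<theta> = \<theta> `` {a}"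
    then show "(\<lambda>\<theta>\<in>\<Phi>. \<theta> `` {f \<theta>}) \<psi> = \<psi> `` {a}" using key[of \<theta> \<psi> a] by simp
  qed
  show "proj (\<lambda>\<theta>\<in>\<Phi>. \<theta> `` {f \<theta>}) \<theta> = f \<theta>" if "\<theta> \<in> \<Phi>"
    using proj_equality[OF * that f(1)[OF that]] that leq_unit_meet[OF f(1) that f(2)] by simp
qed

lemma \<mu>:
  assumes "a \<in> carrier A"
  shows "\<mu> a \<in> carrier P" "\<theta> \<in> \<Phi> \<Longrightarrow> proj (\<mu> a) \<theta> = a \<curlywedge> unit \<theta>"
proof -
  have key: "\<psi> `` {a} = \<psi> `` {b}"
    if h: "\<theta> \<in> \<Phi>" "\<psi> \<in> \<Phi>" "\<theta> \<subseteq> \<psi>" "b \<in> carrier A" "\<theta> `` {a} = \<theta> `` {b}" for \<theta> \<psi> b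
    using h eq_equiv_class_iff[OF \<Phi>_equiv assms h(4)] by blast
  show *: "\<mu> a \<in> carrier P"
    unfolding carrier_P profinite_map_def
  proof (intro conjI ballI impI)
    show "(\<lambda>\<theta>\<in>\<Phi>. \<theta> `` {a}) \<in> (\<Pi>\<^sub>E \<theta>\<in>\<Phi>. carrier A // \<theta>)" using assms by (simp add: quotientI)
  next
    fix \<theta> \<psi> b
    assume h: "\<theta> \<in> \<Phi>" "\<psi> \<in> \<Phi>" "\<theta> \<subseteq> \<psi>" "b \<in> carrier A" "(\<lambda>\<theta>\<in>\<Phi>. \<theta> `` {a}) \<theta> = \<theta> `` {b}"
    then show "(\<lambda>\<theta>\<in>\<Phi>. \<theta> `` {a}) \<psi> = \<psi> `` {b}" using key[of \<theta> \<psi> b] by simp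
  qed
  show "proj (\<mu> a) \<theta> = a \<curlywedge> unit \<theta>" if "\<theta> \<in> \<Phi>"
    by (rule proj_equality[OF * that assms]) (use that in \<open>simp add: profinite_map_def\<close>)
qed

section \<open>The order of the completion and approximation by elements of the algebra\<close>

abbreviation le_P (infix "\<preceq>\<^sub>P" 50) where "\<alpha> \<preceq>\<^sub>P \<beta> \<equiv> \<alpha> \<sqsubseteq>\<^bsub>lattice_of P\<^esub> \<beta>"

text \<open>The join of two projections is again below \<open>unit \<theta>\<close>, so equality of
  classes in the quotient is equality of elements.\<close>

lemma le_P_iff:
  assumes \<alpha>: "\<alpha> \<in> carrier P" and \<beta>: "\<beta> \<in> carrier P"
  shows "\<alpha> \<preceq>\<^sub>P \<beta> \<longleftrightarrow> (\<forall>\<theta>\<in>\<Phi>. proj \<alpha> \<theta> \<preceq> proj \<beta> \<theta>)"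
proof -
  have pt: "mjoin (quotient_algebra A \<theta>) (\<alpha> \<theta>) (\<beta> \<theta>) = \<beta> \<theta> \<longleftrightarrow> proj \<alpha> \<theta> \<preceq> proj \<beta> \<theta>"
    if \<theta>: "\<theta> \<in> \<Phi>" for \<theta>
  proof -
    note p = proj[OF \<alpha> \<theta>] and q = proj[OF \<beta> \<theta>]
    have j: "proj \<alpha> \<theta> \<curlyvee> proj \<beta> \<theta> \<in> carrier A" "proj \<alpha> \<theta> \<curlyvee> proj \<beta> \<theta> \<preceq> unit \<theta>"
      using p q \<theta> by (simp_all add: join_leq_iff)
    have "mjoin (quotient_algebra A \<theta>) (\<alpha> \<theta>) (\<beta> \<theta>) = \<theta> `` {proj \<alpha> \<theta> \<curlyvee> proj \<beta> \<theta>}"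
      using quotient_join[OF \<theta> p(1) q(1)] p(3) q(3) by simp
    then have "mjoin (quotient_algebra A \<theta>) (\<alpha> \<theta>) (\<beta> \<theta>) = \<beta> \<theta> \<longleftrightarrow>
        (proj \<alpha> \<theta> \<curlyvee> proj \<beta> \<theta>) \<curlywedge> unit \<theta> = proj \<beta> \<theta> \<curlywedge> unit \<theta>"
      using class_eq_iff[OF \<theta> j(1) q(1)] q(3) by simp
    then show ?thesis
      using leq_unit_meet[OF j(1) \<theta> j(2)] leq_unit_meet[OF q(1) \<theta> q(2)] by simp
  qed
  have join: "mjoin P \<alpha> \<beta> = (\<lambda>\<theta>\<in>\<Phi>. mjoin (quotient_algebra A \<theta>) (\<alpha> \<theta>) (\<beta> \<theta>))"
    by (simp add: profinite_completion_def Let_def)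
  have "\<beta> \<in> extensional \<Phi>" using \<beta> by (simp add: carrier_P PiE_iff)
  then have "mjoin P \<alpha> \<beta> = \<beta> \<longleftrightarrow> (\<forall>\<theta>\<in>\<Phi>. mjoin (quotient_algebra A \<theta>) (\<alpha> \<theta>) (\<beta> \<theta>) = \<beta> \<theta>)"
    unfolding join by (auto simp: fun_eq_iff extensional_def)
  then show ?thesis using pt by simp
qed

lemma partial_order_P: "partial_order (lattice_of P)"
proof
  show "(.=\<^bsub>lattice_of P\<^esub>) = (=)" by (simp add: lattice_of_def)
  show "\<alpha> \<preceq>\<^sub>P \<alpha>" if "\<alpha> \<in> carrier (lattice_of P)" for \<alpha>
  proof -
    have "\<alpha> \<in> carrier P" using that by simp
    then show ?thesis by (simp only: le_P_iff) (simp add: proj join_idem)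
  qed
  show "\<alpha> .=\<^bsub>lattice_of P\<^esub> \<beta>" if "\<alpha> \<preceq>\<^sub>P \<beta>" "\<beta> \<preceq>\<^sub>P \<alpha>"
    "\<alpha> \<in> carrier (lattice_of P)" "\<beta> \<in> carrier (lattice_of P)" for \<alpha> \<beta>
  proof -
    have c: "\<alpha> \<in> carrier P" "\<beta> \<in> carrier P" using that by simp_all
    have "proj \<alpha> \<theta> = proj \<beta> \<theta>" if "\<theta> \<in> \<Phi>" for \<theta>
      using \<open>\<alpha> \<preceq>\<^sub>P \<beta>\<close> \<open>\<beta> \<preceq>\<^sub>P \<alpha>\<close> that proj(1)[OF c(1) that] proj(1)[OF c(2) that]
      unfolding le_P_iff[OF c] le_P_iff[OF c(2,1)] by (blast intro: leq_antisym)
    then show ?thesis using proj_ext[OF c] by simp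
  qed
  show "\<alpha> \<preceq>\<^sub>P \<gamma>" if "\<alpha> \<preceq>\<^sub>P \<beta>" "\<beta> \<preceq>\<^sub>P \<gamma>" "\<alpha> \<in> carrier (lattice_of P)"
    "\<beta> \<in> carrier (lattice_of P)" "\<gamma> \<in> carrier (lattice_of P)" for \<alpha> \<beta> \<gamma>
  proof -
    have c: "\<alpha> \<in> carrier P" "\<beta> \<in> carrier P" "\<gamma> \<in> carrier P" using that by simp_all
    show ?thesis
      unfolding le_P_iff[OF c(1,3)]
    proof
      fix \<theta> assume \<theta>: "\<theta> \<in> \<Phi>"
      have "proj \<alpha> \<theta> \<preceq> proj \<beta> \<theta>" "proj \<beta> \<theta> \<preceq> proj \<gamma> \<theta>"
        using \<open>\<alpha> \<preceq>\<^sub>P \<beta>\<close> \<open>\<beta> \<preceq>\<^sub>P \<gamma>\<close> \<theta> unfolding le_P_iff[OF c(1,2)] le_P_iff[OF c(2,3)] by blast+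
      then show "proj \<alpha> \<theta> \<preceq> proj \<gamma> \<theta>" by (rule leq_trans) (use c \<theta> proj in blast)+
    qed
  qed
qed (simp_all add: equivalence_def)

interpretation P: partial_order "lattice_of P"
  by (rule partial_order_P)

lemma \<mu>_le_iff:
  "a \<in> carrier A \<Longrightarrow> \<alpha> \<in> carrier P \<Longrightarrow> \<mu> a \<preceq>\<^sub>P \<alpha> \<longleftrightarrow> (\<forall>\<theta>\<in>\<Phi>. a \<curlywedge> unit \<theta> \<preceq> proj \<alpha> \<theta>)"
  by (simp only: le_P_iff \<mu> cong: ball_cong)

text \<open>Here \<open>a\<close> appears without its unit, because
  \<open>proj \<alpha> \<theta>\<close> is already below \<open>unit \<theta>\<close>.\<close>

lemma le_\<mu>_iff:
  "a \<in> carrier A \<Longrightarrow> \<alpha> \<in> carrier P \<Longrightarrow> \<alpha> \<preceq>\<^sub>P \<mu> a \<longleftrightarrow> (\<forall>\<theta>\<in>\<Phi>. proj \<alpha> \<theta> \<preceq> a)"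
  by (simp only: le_P_iff \<mu> leq_meet_iff proj unit_closed simp_thms cong: ball_cong)

text \<open>By \<open>proj_cross\<close> the coordinate of the left side at \<open>\<psi>\<close> is
  a restriction of \<open>proj \<alpha> \<psi>\<close>. The bound from above uses the same identity
  together with residuation.\<close>

lemma \<mu>_proj_le:
  assumes "\<alpha> \<in> carrier P" "\<theta> \<in> \<Phi>"
  shows "\<mu> (proj \<alpha> \<theta>) \<preceq>\<^sub>P \<alpha>"
  unfolding \<mu>_le_iff[OF proj(1)[OF assms] assms(1)]
proof
  fix \<psi> assume \<psi>: "\<psi> \<in> \<Phi>"
  show "proj \<alpha> \<theta> \<curlywedge> unit \<psi> \<preceq> proj \<alpha> \<psi>"
    unfolding proj_cross[OF assms \<psi>] using proj(1)[OF assms(1) \<psi>] assms(2) by (intro meet_lower) auto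
qed

lemma le_\<mu>_proj:
  assumes "\<alpha> \<in> carrier P" "\<theta> \<in> \<Phi>"
  shows "\<alpha> \<preceq>\<^sub>P \<mu> (proj \<alpha> \<theta> \<curlyvee> \<sim> (unit \<theta>))"
proof -
  note p = proj(1)[OF assms]
  have "proj \<alpha> \<psi> \<preceq> proj \<alpha> \<theta> \<curlyvee> \<sim> (unit \<theta>)" if \<psi>: "\<psi> \<in> \<Phi>" for \<psi>
  proof -
    have "proj \<alpha> \<psi> \<curlywedge> unit \<theta> \<preceq> proj \<alpha> \<theta>"
      unfolding proj_cross[OF assms \<psi>, symmetric] using p \<psi> by (intro meet_lower) auto
    then show ?thesis using p proj(1)[OF assms(1) \<psi>] assms(2) by (simp add: residuation)
  qed
  then show ?thesis using le_\<mu>_iff[of "proj \<alpha> \<theta> \<curlyvee> \<sim> (unit \<theta>)" \<alpha>] p assms by simp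
qed

text \<open>Elements of \<open>A\<close> whose images are lower bounds of \<open>S\<close> form an
  ideal; its greatest members below the various units are the coordinates of the infimum.\<close>

lemma complete_lattice_P: "complete_lattice (lattice_of P)"
proof (rule P.complete_lattice_criterion1)
  have "\<alpha> \<preceq>\<^sub>P \<mu> (mtop A)" if "\<alpha> \<in> carrier P" for \<alpha>
    using le_\<mu>_iff[OF op_closed(2) that] proj(1)[OF that] leq_top by blast
  then have "greatest (lattice_of P) (\<mu> (mtop A)) (carrier (lattice_of P))"
    unfolding greatest_def using \<mu>(1)[of "mtop A"] by (simp del: lattice_of_simps(2))
  then show "\<exists>g. greatest (lattice_of P) g (carrier (lattice_of P))" by blast
next
  fix S assume "S \<subseteq> carrier (lattice_of P)"
  then have S: "s \<in> carrier P" if "s \<in> S" for s using that by auto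
  define I where "I = {a \<in> carrier A. \<forall>s\<in>S. \<forall>\<theta>\<in>\<Phi>. a \<curlywedge> unit \<theta> \<preceq> proj s \<theta>}"
  have I_iff: "a \<in> I \<longleftrightarrow> (\<forall>s\<in>S. \<mu> a \<preceq>\<^sub>P s)" if "a \<in> carrier A" for a
    using \<mu>_le_iff[OF that S] that by (simp add: I_def)
  have "\<exists>a\<in>I. a \<preceq> unit \<theta> \<and> (\<forall>b\<in>I. b \<curlywedge> unit \<theta> \<preceq> a)" if \<theta>: "\<theta> \<in> \<Phi>" for \<theta>
  proof (rule ideal_max_below_unit[OF _ _ _ _ \<theta>])
    show "I \<subseteq> carrier A" by (auto simp: I_def)
    have "mbot A \<curlywedge> unit \<psi> \<preceq> proj s \<psi>" if "s \<in> S" "\<psi> \<in> \<Phi>" for s \<psi>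
      using meet_comm[of "mbot A" "unit \<psi>"] that S proj(1) by (simp add: meet_bot bot_leq)
    then show "mbot A \<in> I" by (simp add: I_def)
    show "x \<curlyvee> y \<in> I" if "x \<in> I" "y \<in> I" for x y
      using that S proj(1) by (simp add: I_def join_meet_distrib_right join_leq_iff)
    show "y \<in> I" if xy: "x \<in> I" "y \<in> carrier A" "y \<preceq> x" for x y
    proof -
      have "y \<curlywedge> unit \<psi> \<preceq> proj s \<psi>" if h: "s \<in> S" "\<psi> \<in> \<Phi>" for s \<psi>
      proof (rule leq_trans)
        show "y \<curlywedge> unit \<psi> \<preceq> x \<curlywedge> unit \<psi>"
          using xy h by (intro meet_mono) (simp_all add: I_def join_idem)
      qed (use xy h S proj(1) in \<open>simp_all add: I_def\<close>)
      then show ?thesis using xy by (simp add: I_def)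
    qed
  qed
  then obtain f where f: "\<And>\<theta>. \<theta> \<in> \<Phi> \<Longrightarrow> f \<theta> \<in> I" "\<And>\<theta>. \<theta> \<in> \<Phi> \<Longrightarrow> f \<theta> \<preceq> unit \<theta>"
    "\<And>\<theta> b. \<theta> \<in> \<Phi> \<Longrightarrow> b \<in> I \<Longrightarrow> b \<curlywedge> unit \<theta> \<preceq> f \<theta>"
    by metis
  have fc: "f \<theta> \<in> carrier A" if "\<theta> \<in> \<Phi>" for \<theta> using f(1)[OF that] by (simp add: I_def)
  \<comment> \<open>Maximality forces coherence: \<open>f \<psi>\<close> is a member of
    \<open>I\<close> below the larger \<open>unit \<theta>\<close>, and
    \<open>f \<theta> \<curlywedge> unit \<psi>\<close> is bounded by the choice of
    \<open>f \<psi>\<close>.\<close>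
  have coh: "f \<psi> = f \<theta> \<curlywedge> unit \<psi>" if h: "\<theta> \<in> \<Phi>" "\<psi> \<in> \<Phi>" "\<theta> \<subseteq> \<psi>" for \<theta> \<psi>
  proof (rule leq_antisym)
    have "f \<psi> \<preceq> unit \<theta>"
      using leq_trans[OF f(2)[OF h(2)] unit_mono[OF h]] fc h by simp
    then have "f \<psi> \<preceq> f \<theta>"
      using f(3)[OF h(1) f(1)[OF h(2)]] leq_unit_meet[OF fc[OF h(2)] h(1)] by simp
    then show "f \<psi> \<preceq> f \<theta> \<curlywedge> unit \<psi>" using f(2) fc h by (simp add: leq_meet_iff)
    show "f \<theta> \<curlywedge> unit \<psi> \<preceq> f \<psi>" by (rule f(3)[OF h(2) f(1)[OF h(1)]])
  qed (use fc h in simp_all)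
  define g where "g = (\<lambda>\<theta>\<in>\<Phi>. \<theta> `` {f \<theta>})"
  have gP: "g \<in> carrier P" unfolding g_def by (rule thread(1)[of f, OF fc f(2) coh])
  have g: "proj g \<theta> = f \<theta>" if "\<theta> \<in> \<Phi>" for \<theta>
    unfolding g_def by (rule thread(2)[of f, OF fc f(2) coh that])
  have g_lower: "g \<preceq>\<^sub>P s" if s: "s \<in> S" for s
    unfolding le_P_iff[OF gP S[OF s]]
  proof
    fix \<theta> assume \<theta>: "\<theta> \<in> \<Phi>"
    have "f \<theta> \<curlywedge> unit \<theta> \<preceq> proj s \<theta>" using f(1)[OF \<theta>] s \<theta> by (simp add: I_def)
    then show "proj g \<theta> \<preceq> proj s \<theta>" using g[OF \<theta>] leq_unit_meet[OF fc[OF \<theta>] \<theta> f(2)[OF \<theta>]] by simp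
  qed
  have g_greatest: "\<beta> \<preceq>\<^sub>P g" if \<beta>: "\<beta> \<in> carrier P" and lower: "\<And>s. s \<in> S \<Longrightarrow> \<beta> \<preceq>\<^sub>P s" for \<beta>
    unfolding le_P_iff[OF \<beta> gP]
  proof
    fix \<theta> assume \<theta>: "\<theta> \<in> \<Phi>"
    note p = proj[OF \<beta> \<theta>]
    \<comment> \<open>A lower bound from the completion is tested through its approximations, which
      come from \<open>A\<close> and therefore lie in \<open>I\<close>.\<close>
    have "\<mu> (proj \<beta> \<theta>) \<preceq>\<^sub>P s" if "s \<in> S" for s
      by (rule P.le_trans[OF \<mu>_proj_le[OF \<beta> \<theta>] lower[OF that]])
        (use \<mu>(1)[OF p(1)] \<beta> S[OF that] in simp_all)
    then have "proj \<beta> \<theta> \<in> I" using I_iff[OF p(1)] by blast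
    then have "proj \<beta> \<theta> \<curlywedge> unit \<theta> \<preceq> f \<theta>" by (rule f(3)[OF \<theta>])
    then show "proj \<beta> \<theta> \<preceq> proj g \<theta>" using g[OF \<theta>] leq_unit_meet[OF p(1) \<theta> p(2)] by simp
  qed
  have "greatest (lattice_of P) g (Lower (lattice_of P) S)"
  proof (rule greatest_LowerI)
    fix \<beta> assume "\<beta> \<in> Lower (lattice_of P) S"
    then have "\<beta> \<in> carrier P" "\<And>s. s \<in> S \<Longrightarrow> \<beta> \<preceq>\<^sub>P s"
      using \<open>S \<subseteq> _\<close> unfolding Lower_def by auto
    then show "\<beta> \<preceq>\<^sub>P g" by (rule g_greatest)
  qed (use g_lower \<open>S \<subseteq> _\<close> gP in simp_all)
  then show "\<exists>i. greatest (lattice_of P) i (Lower (lattice_of P) S)" by blast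
qed

section \<open>The embedding into the completion and its densities\<close>

lemma \<mu>_inj: "inj_on \<mu> (carrier A)"
proof (rule inj_onI)
  fix a b assume ab: "a \<in> carrier A" "b \<in> carrier A" "\<mu> a = \<mu> b"
  then have "\<theta> `` {a} = \<theta> `` {b}" if "\<theta> \<in> \<Phi>" for \<theta>
    using that by (metis profinite_map_def restrict_apply')
  then show "a = b" using residual ab unfolding residually_finite_def by blast
qed

text \<open>Distributivity makes restriction to a unit commute with joins, so upper bounds can be
  checked coordinatewise.\<close>

lemma \<mu>_join:
  assumes ab: "a \<in> carrier A" "b \<in> carrier A"
  shows "\<mu> a \<squnion>\<^bsub>lattice_of P\<^esub> \<mu> b = \<mu> (a \<curlyvee> b)"
  unfolding join_def
proof (rule P.sup_equality)
  show "\<alpha> \<preceq>\<^sub>P \<mu> (a \<curlyvee> b)" if "\<alpha> \<in> {\<mu> a, \<mu> b}" for \<alpha>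
  proof -
    have "\<mu> c \<preceq>\<^sub>P \<mu> (a \<curlyvee> b)" if "c \<in> {a, b}" for c
    proof -
      have c: "c \<in> carrier A" "c \<preceq> a \<curlyvee> b" using that ab by (auto simp: join_upper)
      have "c \<curlywedge> unit \<theta> \<preceq> a \<curlyvee> b" if "\<theta> \<in> \<Phi>" for \<theta>
        by (rule leq_trans[OF meet_lower(1) c(2)]) (use that ab c in auto)
      then show ?thesis using le_\<mu>_iff[OF op_closed(5)[OF ab] \<mu>(1)[OF c(1)]] \<mu>(2)[OF c(1)] by simp
    qed
    then show ?thesis using that by blast
  qed
  show "\<mu> (a \<curlyvee> b) \<preceq>\<^sub>P \<gamma>" if \<gamma>: "\<gamma> \<in> carrier (lattice_of P)" and u: "\<And>\<alpha>. \<alpha> \<in> {\<mu> a, \<mu> b} \<Longrightarrow> \<alpha> \<preceq>\<^sub>P \<gamma>" for \<gamma>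
  proof -
    have \<gamma>': "\<gamma> \<in> carrier P" using \<gamma> by simp
    have "a \<curlywedge> unit \<theta> \<preceq> proj \<gamma> \<theta>" "b \<curlywedge> unit \<theta> \<preceq> proj \<gamma> \<theta>" if "\<theta> \<in> \<Phi>" for \<theta>
      using u that \<mu>_le_iff[OF ab(1) \<gamma>'] \<mu>_le_iff[OF ab(2) \<gamma>'] by blast+
    then have "(a \<curlyvee> b) \<curlywedge> unit \<theta> \<preceq> proj \<gamma> \<theta>" if "\<theta> \<in> \<Phi>" for \<theta>
      using that ab proj(1)[OF \<gamma>' that] by (simp add: join_meet_distrib_right join_leq_iff)
    then show ?thesis using \<mu>_le_iff[OF op_closed(5)[OF ab] \<gamma>'] by blast
  qed
qed (use ab \<mu>(1) in simp_all)

lemma \<mu>_meet: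
  assumes ab: "a \<in> carrier A" "b \<in> carrier A"
  shows "\<mu> a \<sqinter>\<^bsub>lattice_of P\<^esub> \<mu> b = \<mu> (a \<curlywedge> b)"
  unfolding meet_def
proof (rule P.inf_equality)
  show "\<mu> (a \<curlywedge> b) \<preceq>\<^sub>P \<alpha>" if "\<alpha> \<in> {\<mu> a, \<mu> b}" for \<alpha>
  proof -
    have "\<mu> (a \<curlywedge> b) \<preceq>\<^sub>P \<mu> c" if "c \<in> {a, b}" for c
    proof -
      have c: "c \<in> carrier A" "a \<curlywedge> b \<preceq> c" using that ab by (auto simp: meet_lower)
      have "(a \<curlywedge> b) \<curlywedge> unit \<theta> \<preceq> c" if "\<theta> \<in> \<Phi>" for \<theta>
        by (rule leq_trans[OF meet_lower(1) c(2)]) (use that ab c in auto)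
      then show ?thesis
        using le_\<mu>_iff[OF c(1) \<mu>(1)[OF op_closed(6)[OF ab]]] \<mu>(2)[OF op_closed(6)[OF ab]] by simp
    qed
    then show ?thesis using that by blast
  qed
  show "\<gamma> \<preceq>\<^sub>P \<mu> (a \<curlywedge> b)" if \<gamma>: "\<gamma> \<in> carrier (lattice_of P)" and l: "\<And>\<alpha>. \<alpha> \<in> {\<mu> a, \<mu> b} \<Longrightarrow> \<gamma> \<preceq>\<^sub>P \<alpha>" for \<gamma>
  proof -
    have \<gamma>': "\<gamma> \<in> carrier P" using \<gamma> by simp
    have "proj \<gamma> \<theta> \<preceq> a" "proj \<gamma> \<theta> \<preceq> b" if "\<theta> \<in> \<Phi>" for \<theta>
      using l that le_\<mu>_iff[OF ab(1) \<gamma>'] le_\<mu>_iff[OF ab(2) \<gamma>'] by blast+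
    then have "proj \<gamma> \<theta> \<preceq> a \<curlywedge> b" if "\<theta> \<in> \<Phi>" for \<theta>
      using that ab proj(1)[OF \<gamma>' that] by (simp add: leq_meet_iff)
    then show ?thesis using le_\<mu>_iff[OF op_closed(6)[OF ab] \<gamma>'] by blast
  qed
qed (use ab \<mu>(1) in simp_all)

text \<open>An upper bound of the images of all \<open>proj \<alpha> \<theta>\<close> dominates
  \<open>\<alpha>\<close> because coordinate \<open>\<theta>\<close> of the
  \<open>\<theta>\<close>-th image is already \<open>proj \<alpha> \<theta>\<close>.\<close>

lemma join_dense_\<mu>: "join_dense (lattice_of P) (\<mu> ` carrier A)"
  unfolding join_dense_def
proof
  fix \<alpha> assume "\<alpha> \<in> carrier (lattice_of P)"
  then have \<alpha>: "\<alpha> \<in> carrier P" by simp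
  let ?S = "(\<lambda>\<theta>. \<mu> (proj \<alpha> \<theta>)) ` \<Phi>"
  have S: "?S \<subseteq> \<mu> ` carrier A" using proj(1)[OF \<alpha>] by auto
  have "\<Squnion>\<^bsub>lattice_of P\<^esub> ?S = \<alpha>"
  proof (rule P.sup_equality)
    show "\<beta> \<preceq>\<^sub>P \<alpha>" if "\<beta> \<in> ?S" for \<beta> using that \<mu>_proj_le[OF \<alpha>] by blast
    show "\<alpha> \<preceq>\<^sub>P \<gamma>" if \<gamma>: "\<gamma> \<in> carrier (lattice_of P)" and u: "\<And>\<beta>. \<beta> \<in> ?S \<Longrightarrow> \<beta> \<preceq>\<^sub>P \<gamma>" for \<gamma>
    proof -
      have \<gamma>': "\<gamma> \<in> carrier P" using \<gamma> by simp
      have "proj \<alpha> \<theta> \<preceq> proj \<gamma> \<theta>" if \<theta>: "\<theta> \<in> \<Phi>" for \<theta>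
      proof -
        note p = proj[OF \<alpha> \<theta>]
        have "\<mu> (proj \<alpha> \<theta>) \<preceq>\<^sub>P \<gamma>" using u \<theta> by blast
        then have "proj \<alpha> \<theta> \<curlywedge> unit \<theta> \<preceq> proj \<gamma> \<theta>" using \<mu>_le_iff[OF p(1) \<gamma>'] \<theta> by blast
        then show ?thesis using leq_unit_meet[OF p(1) \<theta> p(2)] by simp
      qed
      then show ?thesis using le_P_iff[OF \<alpha> \<gamma>'] by blast
    qed
  qed (use \<alpha> S \<mu>(1) in auto)
  then show "\<exists>S\<subseteq>\<mu> ` carrier A. \<alpha> = \<Squnion>\<^bsub>lattice_of P\<^esub> S" using S by metis
qed

text \<open>At coordinate \<open>\<theta>\<close>, residuation removes the added
  \<open>\<sim> (unit \<theta>)\<close>, since projections there lie below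
  \<open>unit \<theta>\<close>.\<close>

lemma meet_dense_\<mu>: "meet_dense (lattice_of P) (\<mu> ` carrier A)"
  unfolding meet_dense_def
proof
  fix \<alpha> assume "\<alpha> \<in> carrier (lattice_of P)"
  then have \<alpha>: "\<alpha> \<in> carrier P" by simp
  let ?b = "\<lambda>\<theta>. proj \<alpha> \<theta> \<curlyvee> \<sim> (unit \<theta>)"
  have b: "?b \<theta> \<in> carrier A" if "\<theta> \<in> \<Phi>" for \<theta> using proj(1)[OF \<alpha> that] that by simp
  let ?S = "(\<lambda>\<theta>. \<mu> (?b \<theta>)) ` \<Phi>"
  have S: "?S \<subseteq> \<mu> ` carrier A" using b by auto
  have "\<Sqinter>\<^bsub>lattice_of P\<^esub> ?S = \<alpha>"
  proof (rule P.inf_equality)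
    show "\<alpha> \<preceq>\<^sub>P \<beta>" if "\<beta> \<in> ?S" for \<beta> using that le_\<mu>_proj[OF \<alpha>] by blast
    show "\<gamma> \<preceq>\<^sub>P \<alpha>" if \<gamma>: "\<gamma> \<in> carrier (lattice_of P)" and l: "\<And>\<beta>. \<beta> \<in> ?S \<Longrightarrow> \<gamma> \<preceq>\<^sub>P \<beta>" for \<gamma>
    proof -
      have \<gamma>': "\<gamma> \<in> carrier P" using \<gamma> by simp
      have "proj \<gamma> \<theta> \<preceq> proj \<alpha> \<theta>" if \<theta>: "\<theta> \<in> \<Phi>" for \<theta>
      proof -
        note p = proj[OF \<alpha> \<theta>] and q = proj[OF \<gamma>' \<theta>]
        have "\<gamma> \<preceq>\<^sub>P \<mu> (?b \<theta>)" using l \<theta> by blast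
        then have "proj \<gamma> \<theta> \<preceq> ?b \<theta>" using le_\<mu>_iff[OF b[OF \<theta>] \<gamma>'] \<theta> by blast
        then have "proj \<gamma> \<theta> \<curlywedge> unit \<theta> \<preceq> proj \<alpha> \<theta>" using residuation p(1) q(1) \<theta> by simp
        then show ?thesis using leq_unit_meet[OF q(1) \<theta> q(2)] by simp
      qed
      then show ?thesis using le_P_iff[OF \<gamma>' \<alpha>] by blast
    qed
  qed (use \<alpha> S \<mu>(1) in auto)
  then show "\<exists>S\<subseteq>\<mu> ` carrier A. \<alpha> = \<Sqinter>\<^bsub>lattice_of P\<^esub> S" using S by metis
qed

lemma macneille_profinite: "macneille_completion (lattice_of A) \<mu> (lattice_of P)"
  unfolding macneille_completion_def lattice_completion_def
  using complete_lattice_P \<mu>(1) \<mu>_inj join_dense_\<mu> meet_dense_\<mu>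
  by (simp add: lattice_of_ops \<mu>_join \<mu>_meet)

end

theorem theorem4p2:
  fixes A :: "'a modal_algebra"
  assumes "modal_algebra A"
    and "residually_finite A"
    and "finitely_generated A"
    and "has_EDPC (HSP A :: nat modal_algebra set)"
  shows "macneille_completion (lattice_of A) (profinite_map A) (lattice_of (profinite_completion A)) \<and>
    (\<forall>(m :: 'a \<Rightarrow> 'c) C. macneille_completion (lattice_of A) m C \<longrightarrow>
       smooth (lattice_of A) m C (mdia A))"
proof -
  interpret modal_algebra A by (rule assms(1))
  obtain n where "\<And>a. a \<in> carrier A \<Longrightarrow> box_iter n a \<preceq> box_iter (Suc n) a"
    using EDPC_imp_box_iter_stable[OF assms(4)] by blast
  then have "\<exists>u. open_element u \<and> finite {x \<in> carrier A. x \<preceq> u} \<and>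
      (\<forall>x\<in>carrier A. \<forall>y\<in>carrier A. (x, y) \<in> \<theta> \<longleftrightarrow> x \<curlywedge> u = y \<curlywedge> u)"
    if "\<theta> \<in> finite_congruences A" for \<theta>
    using finite_congruence_unit[OF _ assms(3) that] by blast
  then have "\<forall>\<theta>\<in>finite_congruences A. \<exists>u. open_element u \<and> finite {x \<in> carrier A. x \<preceq> u} \<and>
      (\<forall>x\<in>carrier A. \<forall>y\<in>carrier A. (x, y) \<in> \<theta> \<longleftrightarrow> x \<curlywedge> u = y \<curlywedge> u)"
    by blast
  \<comment> \<open>Choice only names something determined: such an element is the least one
    congruent to top modulo \<open>\<theta>\<close>.\<close>
  from bchoice[OF this] obtain unit where unit: "\<forall>\<theta>\<in>finite_congruences A.
      open_element (unit \<theta>) \<and> finite {x \<in> carrier A. x \<preceq> unit \<theta>} \<and>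
      (\<forall>x\<in>carrier A. \<forall>y\<in>carrier A. (x, y) \<in> \<theta> \<longleftrightarrow> x \<curlywedge> unit \<theta> = y \<curlywedge> unit \<theta>)"
    by blast
  interpret unital_modal_algebra A unit
    using unit assms(2) by unfold_locales simp_all
  show ?thesis using macneille_profinite smooth_dia by blast
qed

end
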